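(* Let $(\mathscr T_t)_{t\ge 0}$ be an $(X,W)$-Crump-Mode-Jagers branching process satisfying the standing assumptions and Assumption A below. Then, almost surely, the infinite tree $\mathcal T_\infty$ contains a node of infinite degree (an infinite star), i.e. there is $u\in\mathcal T_\infty$ such that $ui\in\mathcal T_\infty$ for infinitely many (indeed all) $i\in\mathbb N$. Assumption A: (1) There exist positive random variables $(Y_n)_{n\in\mathbb N_0}$ with finite mean such that for every $w\in S$ and every $n$, $\sum_{i=n+1}^\infty X_w(i)$ is stochastically dominated by $Y_n$. (2) There exists an increasing sequence $(\lambda_n)_{n\in\mathbb N}\subset(0,\infty)$ with $\lambda_n\to\infty$ such that $$\sum_{n=1}^\infty \mathcal M_{\lambda_n}(Y_n)\,\mathbb E\big[\mathcal L_{\lambda_n}(\mathcal P_n(\varnothing);W)\big]<\infty.$$ (3) $\mathbb E[\sup\{k: X(k)=0\}]<1$, and for each $n\in\mathbb N$, almost surely $\sum_{i=n+1}^\infty X(i)>0$.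
   Context: Ulam–Harris tree: $\mathcal U_\infty=\bigcup_{n\ge0}\mathbb N^n$ with $\mathbb N^0=\{\varnothing\}$ (the root); $u=u_1\cdots u_k$ has length $|u|=k$, $ui$ is the $i$-th child of $u$, and $u_{|\ell}=u_1\cdots u_\ell$ for $\ell\le|u|$ are its ancestors. On a probability space, random maps $X:\mathcal U_\infty\to[0,\infty]$ and $W:\mathcal U_\infty\to S$ ($S$ a measurable space) are given; $W_u$ is the weight of $u$ and $X(uj)$ is the waiting time between the births of the $(j-1)$-th and $j$-th child of $u$. Birth times: $\mathcal B(\varnothing)=0$, $\mathcal B(ui)=\mathcal B(u)+\sum_{j=1}^i X(uj)$. Set $\mathcal P_i(u)=\sum_{j=1}^iX(uj)$, $\mathcal P(u)=\sum_{j=1}^\infty X(uj)$; $\mathcal P_i,\mathcal P$ denote copies of $\mathcal P_i(\varnothing),\mathcal P(\varnothing)$, and $X(i)=X(\varnothing i)$, $W=W_\varnothing$. Standing assumptions: the pairs $((X(uj))_{j\in\mathbb N},W_u)$ are i.i.d. over $u\in\mathcal U_\infty$; writing $(X_w(uj))_{j}$ for $(X(uj))_j$ conditioned on $W_u=w$, the variables $(X_w(ui))_{i\in\mathbb N}$ are mutually independent for each $w\in S$. Let $\mathscr T_t=\{x\in\mathcal U_\infty:\mathcal B(x)\le t\}$, $\tau_k=\inf\{t\ge0:|\mathscr T_t|\ge k\}$, $\mathcal T_k$ the tree of the first $k$ individuals of $\mathscr T_{\tau_k}$ ordered by birth time (ties broken lexicographically), and $\mathcal T_\infty=\bigcup_k\mathcal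 T_k$. Notation: $\mathcal M_\lambda(Y)=\mathbb E[e^{\lambda Y}]$ and $\mathcal L_\lambda(Z;W)=\mathbb E[e^{-\lambda Z}\mid W]$. *)

theory Defs
  imports "HOL-Probability.Probability"
begin

text \<open>Ulam--Harris words: finite lists of positive naturals (children are indexed by 1,2,3,...).\<close>
definition Ulam :: "nat list set" where
  "Ulam = {u. \<forall>i\<in>set u. 0 < i}"

text \<open>Birth time: B(empty)=0, B(u i) = B(u) + sum_{j=1..i} X(u j).\<close>
definition birth :: "(nat list \<Rightarrow> ennreal) \<Rightarrow> nat list \<Rightarrow> ennreal" where
  "birth X u = (\<Sum>l<length u. \<Sum>j=1..u ! l. X (take l u @ [j]))"

text \<open>Individuals born by time t (never-born individuals, with birth time infinity, excluded).\<close>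
definition born :: "(nat list \<Rightarrow> ennreal) \<Rightarrow> ennreal \<Rightarrow> nat list set" where
  "born X t = {x \<in> Ulam. birth X x \<le> t \<and> birth X x \<noteq> \<top>}"

definition ecard :: "'b set \<Rightarrow> enat" where
  "ecard A = (if finite A then enat (card A) else \<infinity>)"

definition tau :: "(nat list \<Rightarrow> ennreal) \<Rightarrow> nat \<Rightarrow> ennreal" where
  "tau X k = Inf {t. enat k \<le> ecard (born X t)}"

definition birth_less :: "(nat list \<Rightarrow> ennreal) \<Rightarrow> nat list \<Rightarrow> nat list \<Rightarrow> bool" where
  "birth_less X x y \<longleftrightarrow> birth X x < birth X y \<or> (birth X x = birth X y \<and> ord_class.lexordp x y)"

definition first_tree :: "(nat list \<Rightarrow> ennreal) \<Rightarrow> nat \<Rightarrow> nat list set" where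
  "first_tree X k = (let A = born X (tau X k) in
     {x \<in> A. finite {y \<in> A. birth_less X y x} \<and> card {y \<in> A. birth_less X y x} < k})"

definition Tinf :: "(nat list \<Rightarrow> ennreal) \<Rightarrow> nat list set" where
  "Tinf X = (\<Union>k. first_tree X k)"

definition exp_neg :: "real \<Rightarrow> ennreal \<Rightarrow> ennreal" where
  "exp_neg l z = (if z = \<top> then 0 else ennreal (exp (- l * enn2real z)))"

end

theory Submission
  imports Defs
begin

text \<open>
  Let \<open>T\<close> be the limit of the times \<open>\<tau>\<^sub>k\<close>. If no node has infinitely many children by time \<open>T\<close>, then
  Konig's lemma yields an infinite path of individuals born by time \<open>T\<close>, none of which has completed
  its reproduction by time \<open>T\<close>. To exclude such paths, follow the running maximum \<open>N\<close> of the labels. Whenever a label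
  exceeds \<open>N\<close>, the parent in question has already produced its \<open>N\<close>-th child; and all
  these births happen before the node of the previous record has had its remaining children, a time
  dominated by \<open>Y\<^sub>N\<close>. By Chernoff's bound with parameter \<open>\<lambda>\<^sub>N\<close>, a record \<open>N\<close> costs
  the \<open>N\<close>-th summand of Assumption A (2), while steps with labels at most \<open>N\<close> have total weight
  \<open>\<Sum>i\<le>N. E exp (- \<lambda>\<^sub>N P\<^sub>i)\<close>, asymptotically at most \<open>E sup {k. X k = 0} < 1\<close>. Hence the total
  weight of all paths of length \<open>m\<close> decays geometrically in \<open>m\<close>, whereas a path as above has
  weight bounded away from \<open>0\<close> infinitely often.
\<close>

section \<open>Partial sums of waiting times and their exponential moments\<close>

abbreviation seqM :: "(nat \<Rightarrow> ennreal) measure" where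
  "seqM \<equiv> \<Pi>\<^sub>M j\<in>UNIV. borel"

text \<open>Sequences are indexed from 0, children from 1: entry \<open>j\<close> is the waiting
  time before child \<open>j + 1\<close>. So \<open>psum n\<close> is the delay until child
  \<open>n\<close>, and \<open>tsum n\<close> the time left after child \<open>n\<close> until the
  node has had all its children.\<close>

definition psum :: "nat \<Rightarrow> (nat \<Rightarrow> ennreal) \<Rightarrow> ennreal" where
  "psum n x = (\<Sum>j<n. x j)"

definition tsum :: "nat \<Rightarrow> (nat \<Rightarrow> ennreal) \<Rightarrow> ennreal" where
  "tsum n x = (\<Sum>i. x (n + i))"

definition exp_pos :: "real \<Rightarrow> ennreal \<Rightarrow> ennreal" where
  "exp_pos l z = (if z = \<top> then \<top> else ennreal (exp (l * enn2real z)))"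

lemma measurable_psum [measurable]: "psum n \<in> borel_measurable seqM"
  unfolding psum_def [abs_def] by measurable

lemma measurable_tsum [measurable]: "tsum n \<in> borel_measurable seqM"
  unfolding tsum_def [abs_def] by measurable

lemma measurable_exp_pos [measurable]: "exp_pos l \<in> borel_measurable borel"
  unfolding exp_pos_def [abs_def] by measurable

lemma measurable_exp_neg [measurable]: "exp_neg l \<in> borel_measurable borel"
  unfolding exp_neg_def [abs_def] by measurable

lemma exp_neg_le_1: "0 \<le> l \<Longrightarrow> exp_neg l z \<le> 1"
  by (auto simp: exp_neg_def)

lemma exp_neg_mono: "0 \<le> l \<Longrightarrow> l \<le> l' \<Longrightarrow> z \<le> z' \<Longrightarrow> exp_neg l' z' \<le> exp_neg l z"
  by (auto simp: exp_neg_def top_unique intro!: mult_mono enn2real_mono simp: less_top)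

lemma psum_mono: "m \<le> n \<Longrightarrow> psum m x \<le> psum n x"
  unfolding psum_def by (intro sum_mono2) auto

lemma psum_plus_tsum: "psum n x + tsum n x = (\<Sum>i. x i)"
  unfolding psum_def tsum_def
  using suminf_offset[of x n] by (simp add: add.commute)

lemma psum_le_suminf: "psum n x \<le> (\<Sum>i. x i)"
  by (metis psum_plus_tsum le_iff_add)

lemma tsum_le_suminf: "tsum n x \<le> (\<Sum>i. x i)"
  by (metis psum_plus_tsum le_iff_add add.commute)

section \<open>Product laws of waiting-time sequences\<close>

lemma sets_PiM_UNIV_eq_seqM:
  assumes "\<And>j. sets (\<mu> j) = sets borel"
  shows "sets (PiM UNIV \<mu>) = sets seqM"
  using assms by (intro sets_PiM_cong) auto

lemma indep_vars_PiM_coordinates: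
  fixes \<mu> :: "'i \<Rightarrow> 'b measure"
  assumes p: "\<And>j. j \<in> I \<Longrightarrow> prob_space (\<mu> j)" and "I \<noteq> {}"
  shows "prob_space.indep_vars (PiM I \<mu>) \<mu> (\<lambda>i x. x i) I"
proof -
  interpret prob_space "PiM I \<mu>" by (rule prob_space_PiM) (rule p)
  \<comment> \<open>Points of the product space are extensional, so restriction to \<open>I\<close>
    is the identity and the joint law of the coordinates is the product measure itself.\<close>
  have "distr (PiM I \<mu>) (PiM I \<mu>) (\<lambda>x. \<lambda>i\<in>I. x i) = distr (PiM I \<mu>) (PiM I \<mu>) (\<lambda>x. x)"
    by (intro distr_cong) (auto simp: space_PiM)
  also have "\<dots> = PiM I \<mu>" by simp
  also have "\<dots> = PiM I (\<lambda>i. distr (PiM I \<mu>) (\<mu> i) (\<lambda>x. x i))"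
    using p by (intro PiM_cong refl distr_PiM_component [symmetric]) auto
  finally show ?thesis
    by (subst indep_vars_iff_distr_eq_PiM') (use \<open>I \<noteq> {}\<close> in auto)
qed

text \<open>Head and tail read disjoint blocks of coordinates, those below \<open>m\<close> and
  those from \<open>n\<close> on, and are therefore independent.\<close>

lemma nn_integral_PiM_psum_tsum:
  fixes \<mu> :: "nat \<Rightarrow> ennreal measure"
  assumes p: "\<And>j. prob_space (\<mu> j)" and s: "\<And>j. sets (\<mu> j) = sets borel"
    and m: "m \<le> n" and f [measurable]: "f \<in> borel_measurable borel" and g [measurable]: "g \<in> borel_measurable borel"
  shows "(\<integral>\<^sup>+ x. f (psum m x) * g (tsum n x) \<partial>PiM UNIV \<mu>)
    = (\<integral>\<^sup>+ x. f (psum m x) \<partial>PiM UNIV \<mu>) * (\<integral>\<^sup>+ x. g (tsum n x) \<partial>PiM UNIV \<mu>)"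
proof -
  interpret prob_space "PiM UNIV \<mu>" by (rule prob_space_PiM) (rule p)
  note s [measurable_cong]
  \<comment> \<open>Indexing the two blocks by \<open>bool\<close> turns them into a family to which
    the grouping rules for \<open>indep_vars\<close> apply; \<open>True\<close> is the head.\<close>
  define K where "K b = (if b then {..<m} else {n..})" for b :: bool
  have "indep_vars \<mu> (\<lambda>i x. x i) UNIV"
    by (rule indep_vars_PiM_coordinates) (auto simp: p)
  then have "indep_vars (\<lambda>b. PiM (K b) \<mu>) (\<lambda>b x. restrict (\<lambda>i. x i) (K b)) UNIV"
    by (rule indep_vars_restrict) (use m in \<open>auto simp: disjoint_family_on_def K_def\<close>)
  moreover have "(if b then (\<lambda>x. f (psum m x)) else (\<lambda>x. g (tsum n x))) \<in> PiM (K b) \<mu> \<rightarrow>\<^sub>M borel" for b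
  proof -
    have c: "(\<lambda>x. x i) \<in> PiM (K b) \<mu> \<rightarrow>\<^sub>M borel" if "i \<in> K b" for i b
      using measurable_component_singleton [OF that, of \<mu>] measurable_cong_sets [OF refl s] by blast
    have "psum m \<in> PiM (K True) \<mu> \<rightarrow>\<^sub>M borel"
      unfolding psum_def [abs_def] by (intro borel_measurable_sum c) (simp add: K_def)
    moreover have "tsum n \<in> PiM (K False) \<mu> \<rightarrow>\<^sub>M borel"
      unfolding tsum_def [abs_def] by (intro borel_measurable_suminf_order c) (simp add: K_def)
    ultimately show ?thesis
      using measurable_compose [OF _ f] measurable_compose [OF _ g] by (cases b) simp_all
  qed
  ultimately have "indep_vars (\<lambda>_. borel)
     (\<lambda>b x. (if b then (\<lambda>x. f (psum m x)) else (\<lambda>x. g (tsum n x))) (restrict x (K b))) UNIV"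
    by (rule indep_vars_compose2)
  from indep_vars_nn_integral [OF _ this]
  show ?thesis
    by (simp add: UNIV_bool K_def psum_def tsum_def mult.commute)
qed

text \<open>Layer-cake formula: each value is the Lebesgue length of the set of levels below it, and
  Fubini exchanges the integrals.\<close>

lemma nn_integral_eq_lborel_tail:
  assumes "sigma_finite_measure M" and f [measurable]: "f \<in> borel_measurable M"
  shows "(\<integral>\<^sup>+ x. f x \<partial>M) = (\<integral>\<^sup>+ t. indicator {0..} t * emeasure M {x \<in> space M. ennreal t < f x} \<partial>lborel)"
proof -
  interpret sigma_finite_measure M by fact
  interpret pair_sigma_finite M lborel ..
  have *: "(\<integral>\<^sup>+ t. indicator {0..} t * indicator {t. ennreal t < y} t \<partial>lborel) = y" for y :: ennreal
  proof -
    have "(\<integral>\<^sup>+ t. indicator {0..} t * indicator {t. ennreal t < y} t \<partial>lborel)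
        = (\<integral>\<^sup>+ t. indicator ({0..} \<inter> {t::real. ennreal t < y}) t \<partial>lborel)"
      by (intro nn_integral_cong) (auto split: split_indicator)
    also have "\<dots> = emeasure lborel ({0..} \<inter> {t::real. ennreal t < y})"
      by (rule nn_integral_indicator) simp
    also have "\<dots> = y"
    proof (cases y)
      case (real r)
      then have "{0..} \<inter> {t::real. ennreal t < y} = {0..<r}"
        by (auto simp: ennreal_less_iff)
      with real show ?thesis by simp
    next
      case top
      then have "{0..} \<inter> {t::real. ennreal t < y} = {0..}" by auto
      moreover have "emeasure lborel {0::real..} = \<top>"
      proof (rule ccontr)
        assume "emeasure lborel {0::real..} \<noteq> \<top>"
        then obtain n where n: "emeasure lborel {0::real..} < of_nat n"
          using ennreal_Ex_less_of_nat by (auto simp: less_top)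
        have "emeasure lborel {0..real n} \<le> emeasure lborel {0::real..}"
          by (intro emeasure_mono) auto
        with n show False by (simp add: ennreal_of_nat_eq_real_of_nat)
      qed
      ultimately show ?thesis using top by simp
    qed
    finally show ?thesis .
  qed
  have "(\<integral>\<^sup>+ x. f x \<partial>M)
      = (\<integral>\<^sup>+ x. \<integral>\<^sup>+ t. indicator {0..} t * indicator {t. ennreal t < f x} t \<partial>lborel \<partial>M)"
    unfolding * ..
  also have "\<dots> = (\<integral>\<^sup>+ t. \<integral>\<^sup>+ x. indicator {0..} t * indicator {t. ennreal t < f x} t \<partial>M \<partial>lborel)"
    by (rule Fubini' [symmetric]) measurable
  also have "\<dots> = (\<integral>\<^sup>+ t. indicator {0..} t * emeasure M {x \<in> space M. ennreal t < f x} \<partial>lborel)"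
  proof (intro nn_integral_cong)
    fix t :: real
    have "(\<integral>\<^sup>+ x. indicator {t. ennreal t < f x} t \<partial>M) = (\<integral>\<^sup>+ x. indicator {x \<in> space M. ennreal t < f x} x \<partial>M)"
      by (intro nn_integral_cong) (auto split: split_indicator)
    then show "(\<integral>\<^sup>+ x. indicator {0..} t * indicator {t. ennreal t < f x} t \<partial>M)
        = indicator {0..} t * emeasure M {x \<in> space M. ennreal t < f x}"
      by (subst nn_integral_cmult) simp_all
  qed
  finally show ?thesis .
qed

lemma nn_integral_exp_pos_le:
  assumes "prob_space M" "prob_space N" and sN [measurable_cong]: "sets N = sets borel"
    and Z [measurable]: "Z \<in> borel_measurable M"
    and pos: "AE y in N. 0 < (y::real)" and l: "0 < l"
    and dom: "\<And>t::real. emeasure M {x \<in> space M. ennreal t < Z x} \<le> emeasure N {y. t < y}"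
  shows "(\<integral>\<^sup>+ x. exp_pos l (Z x) \<partial>M) \<le> (\<integral>\<^sup>+ y. ennreal (exp (l * y)) \<partial>N)"
proof -
  interpret M: prob_space M by fact
  interpret N: prob_space N by fact
  have spN: "space N = UNIV" using sets_eq_imp_space_eq [OF sN] by simp
  have "emeasure M {x \<in> space M. ennreal t < exp_pos l (Z x)} \<le> emeasure N {y \<in> space N. ennreal t < ennreal (exp (l * y))}"
    if t: "0 \<le> t" for t :: real
  \<comment> \<open>Below level 1 the threshold \<open>ln t / l\<close> would be negative and
    \<open>ennreal\<close> would truncate it to 0. Positivity under \<open>N\<close> gives the
    right-hand side full mass instead.\<close>
  proof (cases "t < 1")
    case True
    have "emeasure N {y \<in> space N. ennreal t < ennreal (exp (l * y))} = 1"
    proof (rule N.emeasure_eq_1_AE)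
      show "AE x in N. x \<in> {y \<in> space N. ennreal t < ennreal (exp (l * y))}"
        using pos
      proof eventually_elim
        case (elim y)
        have "t < exp (l * y)" using True l elim by (smt (verit) mult_pos_pos one_less_exp_iff)
        then show ?case using t by (simp add: spN ennreal_less_iff)
      qed
    qed measurable
    then show ?thesis by (simp add: M.emeasure_le_1)
  next
    case False
    then have t1: "1 \<le> t" by simp
    have e: "t < exp (l * y) \<longleftrightarrow> ln t / l < y" for y
    proof -
      have "t < exp (l * y) \<longleftrightarrow> ln t < l * y" using t1 exp_less_cancel_iff [of "ln t" "l * y"] by simp
      then show ?thesis using l by (simp add: field_simps)
    qed
    have lt: "0 \<le> ln t / l" using t1 l by simp
    have "{x \<in> space M. ennreal t < exp_pos l (Z x)} = {x \<in> space M. ennreal (ln t / l) < Z x}"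
    proof -
      have "ennreal t < exp_pos l z \<longleftrightarrow> ennreal (ln t / l) < z" for z
        by (cases z) (use t lt e in \<open>auto simp: exp_pos_def ennreal_less_iff\<close>)
      then show ?thesis by simp
    qed
    moreover have "{y \<in> space N. ennreal t < ennreal (exp (l * y))} = {y. ln t / l < y}"
      using t e by (auto simp: spN ennreal_less_iff)
    ultimately show ?thesis using dom [of "ln t / l"] by simp
  qed
  then show ?thesis
    by (subst (1 2) nn_integral_eq_lborel_tail)
       (auto intro!: nn_integral_mono prob_space_imp_sigma_finite assms split: split_indicator)
qed

text \<open>Cylinder sets are an intersection-stable generator, and on a cylinder the product law is
  a finite product of coordinate kernels.\<close>

lemma measurable_PiM_kernel:
  fixes \<mu> :: "nat \<Rightarrow> 's \<Rightarrow> ennreal measure"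
  assumes k [measurable]: "\<And>j. \<mu> j \<in> S \<rightarrow>\<^sub>M prob_algebra borel"
  shows "(\<lambda>w. PiM UNIV (\<lambda>j. \<mu> j w)) \<in> S \<rightarrow>\<^sub>M prob_algebra seqM"
proof -
  have p: "prob_space (\<mu> j w)" and s: "sets (\<mu> j w) = sets borel" if "w \<in> space S" for j w
    using measurable_space [OF k that] by (auto simp: space_prob_algebra)
  have sp: "space (\<mu> j w) = UNIV" if "w \<in> space S" for j w
    using sets_eq_imp_space_eq [OF s [OF that]] by simp
  show ?thesis
  proof (rule measurable_prob_algebra_generated [OF sets_PiM Int_stable_prod_algebra prod_algebra_sets_into_space])
    fix w assume w: "w \<in> space S"
    show "prob_space (PiM UNIV (\<lambda>j. \<mu> j w))" by (rule prob_space_PiM) (rule p [OF w])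
    show "sets (PiM UNIV (\<lambda>j. \<mu> j w)) = sets seqM" by (rule sets_PiM_UNIV_eq_seqM) (rule s [OF w])
  next
    fix A assume "A \<in> prod_algebra UNIV (\<lambda>_::nat. borel :: ennreal measure)"
    then obtain J E where A: "A = prod_emb UNIV (\<lambda>_::nat. borel) J (Pi\<^sub>E J E)"
      "finite J" "\<And>i. i \<in> J \<Longrightarrow> E i \<in> sets (borel :: ennreal measure)"
      by (rule prod_algebraE) blast
    have "emeasure (PiM UNIV (\<lambda>j. \<mu> j w)) A = (\<Prod>j\<in>J. emeasure (\<mu> j w) (E j))" if w: "w \<in> space S" for w
    proof -
      have "A = prod_emb UNIV (\<lambda>j. \<mu> j w) J (Pi\<^sub>E J E)"
        unfolding A by (simp add: prod_emb_def sp [OF w])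
      then show ?thesis
        using A p [OF w] by (simp add: emeasure_PiM_emb s [OF w])
    qed
    moreover have "(\<lambda>w. \<Prod>j\<in>J. emeasure (\<mu> j w) (E j)) \<in> borel_measurable S"
      using measurable_emeasure_kernel [OF measurable_prob_algebraD [OF k] A(3)]
      by (intro borel_measurable_prod_ennreal) auto
    ultimately show "(\<lambda>w. emeasure (PiM UNIV (\<lambda>j. \<mu> j w)) A) \<in> borel_measurable S"
      by (subst measurable_cong) auto
  qed
qed

section \<open>Weighted path sums along independent families\<close>

text \<open>The state \<open>N\<close> of a path is the running maximum of the labels met so far, floored at the starting value.
  The sum ranges over all paths of length \<open>m\<close> that descend from \<open>y\<close>; each path contributes the product of
  its step weights \<open>g\<close> and a final weight \<open>e\<close>.\<close>

primrec pathsum :: "(nat \<Rightarrow> nat \<Rightarrow> (nat \<Rightarrow> ennreal) \<Rightarrow> ennreal) \<Rightarrow> (nat \<Rightarrow> (nat \<Rightarrow> ennreal) \<Rightarrow> ennreal)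
    \<Rightarrow> (nat list \<Rightarrow> nat \<Rightarrow> ennreal) \<Rightarrow> nat \<Rightarrow> nat \<Rightarrow> nat list \<Rightarrow> ennreal" where
  "pathsum g e \<xi> 0 N y = e N (\<xi> y)"
| "pathsum g e \<xi> (Suc m) N y = (\<Sum>i. g N (Suc i) (\<xi> y) * pathsum g e \<xi> m (max N (Suc i)) (y @ [Suc i]))"

text \<open>With \<open>a\<close> and \<open>b\<close> the expectations of the step and final
  weights, this is the expectation of \<open>pathsum\<close>, by independence of distinct
  nodes.\<close>

primrec expected_pathsum :: "(nat \<Rightarrow> nat \<Rightarrow> ennreal) \<Rightarrow> (nat \<Rightarrow> ennreal) \<Rightarrow> nat \<Rightarrow> nat \<Rightarrow> ennreal" where
  "expected_pathsum a b 0 N = b N"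
| "expected_pathsum a b (Suc m) N = (\<Sum>i. a N (Suc i) * expected_pathsum a b m (max N (Suc i)))"

text \<open>The final weight \<open>b\<close> doubles as a Lyapunov function: one step contracts it
  by \<open>r\<close>, and the state never decreases, so the step bound remains available.\<close>

lemma expected_pathsum_le:
  fixes a :: "nat \<Rightarrow> nat \<Rightarrow> ennreal"
  assumes "\<And>N. n0 \<le> N \<Longrightarrow> (\<Sum>i. a N (Suc i) * b (max N (Suc i))) \<le> r * b N" and "n0 \<le> N"
  shows "expected_pathsum a b m N \<le> r ^ m * b N"
  using assms(2)
proof (induction m arbitrary: N)
  case (Suc m)
  have "expected_pathsum a b (Suc m) N \<le> (\<Sum>i. a N (Suc i) * (r ^ m * b (max N (Suc i))))"
    using Suc by (auto intro!: suminf_le mult_left_mono)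
  also have "\<dots> = r ^ m * (\<Sum>i. a N (Suc i) * b (max N (Suc i)))"
    by (simp add: mult.left_commute)
  also have "\<dots> \<le> r ^ m * (r * b N)"
    using assms(1) Suc.prems by (auto intro: mult_left_mono)
  finally show ?case by (simp add: mult_ac)
qed simp

lemma (in prob_space) measurable_pathsum:
  fixes \<xi> :: "'a \<Rightarrow> nat list \<Rightarrow> nat \<Rightarrow> ennreal"
  assumes \<xi> [measurable]: "\<And>u. (\<lambda>\<omega>. \<xi> \<omega> u) \<in> M \<rightarrow>\<^sub>M seqM"
    and g [measurable]: "\<And>N i. g N i \<in> borel_measurable seqM"
    and e [measurable]: "\<And>N. e N \<in> borel_measurable seqM"
  shows "(\<lambda>\<omega>. pathsum g e (\<xi> \<omega>) m N y) \<in> borel_measurable M"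
proof (induction m arbitrary: N y)
  case (Suc m)
  note Suc [measurable]
  show ?case by simp
qed simp

text \<open>The product over \<open>I\<close> records the nodes already visited, so that the
  induction can absorb the factor at \<open>y\<close> before descending. Words in \<open>I\<close>
  are shorter than \<open>y\<close>, hence \<open>y\<close> is new and its factor
  independent.\<close>

lemma (in prob_space) nn_integral_prod_pathsum:
  fixes \<xi> :: "'a \<Rightarrow> nat list \<Rightarrow> nat \<Rightarrow> ennreal"
  assumes \<xi> [measurable]: "\<And>u. (\<lambda>\<omega>. \<xi> \<omega> u) \<in> M \<rightarrow>\<^sub>M seqM"
    and ind: "indep_vars (\<lambda>_. seqM) (\<lambda>u \<omega>. \<xi> \<omega> u) Ulam"
    and g [measurable]: "\<And>N i. g N i \<in> borel_measurable seqM"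
    and e [measurable]: "\<And>N. e N \<in> borel_measurable seqM"
    and a: "\<And>N i u. u \<in> Ulam \<Longrightarrow> (\<integral>\<^sup>+ \<omega>. g N i (\<xi> \<omega> u) \<partial>M) = a N i"
    and b: "\<And>N u. u \<in> Ulam \<Longrightarrow> (\<integral>\<^sup>+ \<omega>. e N (\<xi> \<omega> u) \<partial>M) = b N"
    and f: "\<And>u. f u \<in> borel_measurable seqM"
    and I: "finite I" "I \<subseteq> Ulam" "\<And>u. u \<in> I \<Longrightarrow> length u < length y" and y: "y \<in> Ulam"
  shows "(\<integral>\<^sup>+ \<omega>. (\<Prod>u\<in>I. f u (\<xi> \<omega> u)) * pathsum g e (\<xi> \<omega>) m N y \<partial>M)
    = (\<Prod>u\<in>I. \<integral>\<^sup>+ \<omega>. f u (\<xi> \<omega> u) \<partial>M) * expected_pathsum a b m N"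
proof -
  have prod: "(\<integral>\<^sup>+ \<omega>. (\<Prod>u\<in>I. f u (\<xi> \<omega> u)) \<partial>M) = (\<Prod>u\<in>I. \<integral>\<^sup>+ \<omega>. f u (\<xi> \<omega> u) \<partial>M)"
    if "finite I" "I \<subseteq> Ulam" "\<And>u. f u \<in> borel_measurable seqM" for I f
    by (rule indep_vars_nn_integral [OF that(1)])
       (use indep_vars_compose2 [OF indep_vars_subset [OF ind that(2)] that(3)] in auto)
  have step: "(\<integral>\<^sup>+ \<omega>. (\<Prod>u\<in>insert y I. (f(y := h)) u (\<xi> \<omega> u)) \<partial>M)
     = (\<Prod>u\<in>I. \<integral>\<^sup>+ \<omega>. f u (\<xi> \<omega> u) \<partial>M) * (\<integral>\<^sup>+ \<omega>. h (\<xi> \<omega> y) \<partial>M)"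
    and insert: "(\<Prod>u\<in>insert y I. (f(y := h)) u (x u)) = (\<Prod>u\<in>I. f u (x u)) * h (x y)"
    if "finite I" "I \<subseteq> Ulam" "\<And>u. u \<in> I \<Longrightarrow> length u < length y" "y \<in> Ulam"
      "\<And>u. f u \<in> borel_measurable seqM" "h \<in> borel_measurable seqM"
    for I f h y and x :: "nat list \<Rightarrow> nat \<Rightarrow> ennreal"
  proof -
    have y: "y \<notin> I" using that(3) by auto
    have eq: "(\<Prod>u\<in>I. (f(y := h)) u (x u)) = (\<Prod>u\<in>I. f u (x u))" for x :: "nat list \<Rightarrow> nat \<Rightarrow> ennreal"
      using y by (intro prod.cong) auto
    then show "(\<Prod>u\<in>insert y I. (f(y := h)) u (x u)) = (\<Prod>u\<in>I. f u (x u)) * h (x y)"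
      using that y by (simp del: fun_upd_apply add: mult.commute) simp
    have "(\<integral>\<^sup>+ \<omega>. (\<Prod>u\<in>insert y I. (f(y := h)) u (\<xi> \<omega> u)) \<partial>M)
        = (\<Prod>u\<in>insert y I. \<integral>\<^sup>+ \<omega>. (f(y := h)) u (\<xi> \<omega> u) \<partial>M)"
      by (rule prod) (use that in auto)
    also have "\<dots> = (\<Prod>u\<in>I. \<integral>\<^sup>+ \<omega>. (f(y := h)) u (\<xi> \<omega> u) \<partial>M) * (\<integral>\<^sup>+ \<omega>. h (\<xi> \<omega> y) \<partial>M)"
      using that y by (simp del: fun_upd_apply add: mult.commute) simp
    also have "(\<Prod>u\<in>I. \<integral>\<^sup>+ \<omega>. (f(y := h)) u (\<xi> \<omega> u) \<partial>M) = (\<Prod>u\<in>I. \<integral>\<^sup>+ \<omega>. f u (\<xi> \<omega> u) \<partial>M)"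
      using y by (intro prod.cong) auto
    finally show "(\<integral>\<^sup>+ \<omega>. (\<Prod>u\<in>insert y I. (f(y := h)) u (\<xi> \<omega> u)) \<partial>M)
       = (\<Prod>u\<in>I. \<integral>\<^sup>+ \<omega>. f u (\<xi> \<omega> u) \<partial>M) * (\<integral>\<^sup>+ \<omega>. h (\<xi> \<omega> y) \<partial>M)" .
  qed
  show ?thesis using f I y
  proof (induction m arbitrary: N y I f)
    case 0
    then show ?case
      using step [of I y f "e N"] insert [of I y f "e N"] b by simp
  next
    case (Suc m)
    note [measurable] = Suc.prems(1) measurable_pathsum [OF \<xi> g e]
    have "(\<integral>\<^sup>+ \<omega>. (\<Prod>u\<in>I. f u (\<xi> \<omega> u)) * pathsum g e (\<xi> \<omega>) (Suc m) N y \<partial>M)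
       = (\<integral>\<^sup>+ \<omega>. (\<Sum>i. ((\<Prod>u\<in>insert y I. (f(y := g N (Suc i))) u (\<xi> \<omega> u)))
            * pathsum g e (\<xi> \<omega>) m (max N (Suc i)) (y @ [Suc i])) \<partial>M)"
      using Suc.prems by (subst insert) (auto simp: mult.assoc)
    also have "\<dots> = (\<Sum>i. \<integral>\<^sup>+ \<omega>. ((\<Prod>u\<in>insert y I. (f(y := g N (Suc i))) u (\<xi> \<omega> u)))
            * pathsum g e (\<xi> \<omega>) m (max N (Suc i)) (y @ [Suc i]) \<partial>M)"
      by (intro nn_integral_suminf) (measurable, auto)
    \<comment> \<open>The induction hypothesis is used with \<open>insert y I\<close> at a child of
      \<open>y\<close>, which is longer than every word in that set.\<close>
    also have "\<dots> = (\<Sum>i. (\<Prod>u\<in>insert y I. \<integral>\<^sup>+ \<omega>. (f(y := g N (Suc i))) u (\<xi> \<omega> u) \<partial>M)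
            * expected_pathsum a b m (max N (Suc i)))"
      using Suc.prems
      by (intro arg_cong [where f = suminf] ext Suc.IH) (auto simp: Ulam_def less_Suc_eq)
    also have "\<dots> = (\<Sum>i. (\<Prod>u\<in>I. \<integral>\<^sup>+ \<omega>. f u (\<xi> \<omega> u) \<partial>M) * (a N (Suc i) * expected_pathsum a b m (max N (Suc i))))"
    proof (intro arg_cong [where f = suminf] ext)
      fix i
      have "(\<Prod>u\<in>insert y I. \<integral>\<^sup>+ \<omega>. (f(y := g N (Suc i))) u (\<xi> \<omega> u) \<partial>M)
          = (\<Prod>u\<in>I. \<integral>\<^sup>+ \<omega>. f u (\<xi> \<omega> u) \<partial>M) * a N (Suc i)"
        using step [of I y f "g N (Suc i)", OF Suc.prems(2,3,4,5,1) g] prod [of "insert y I" "f(y := g N (Suc i))"] Suc.prems a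
        by simp
      then show "(\<Prod>u\<in>insert y I. \<integral>\<^sup>+ \<omega>. (f(y := g N (Suc i))) u (\<xi> \<omega> u) \<partial>M) * expected_pathsum a b m (max N (Suc i))
         = (\<Prod>u\<in>I. \<integral>\<^sup>+ \<omega>. f u (\<xi> \<omega> u) \<partial>M) * (a N (Suc i) * expected_pathsum a b m (max N (Suc i)))"
        by (simp only: mult.assoc)
    qed
    finally show ?case by simp
  qed
qed

text \<open>The expectation is at most a geometric series times \<open>b N\<close>, and a finite
  expectation forces almost sure finiteness.\<close>

lemma (in prob_space) AE_suminf_pathsum_finite:
  fixes \<xi> :: "'a \<Rightarrow> nat list \<Rightarrow> nat \<Rightarrow> ennreal"
  assumes \<xi> [measurable]: "\<And>u. (\<lambda>\<omega>. \<xi> \<omega> u) \<in> M \<rightarrow>\<^sub>M seqM"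
    and ind: "indep_vars (\<lambda>_. seqM) (\<lambda>u \<omega>. \<xi> \<omega> u) Ulam"
    and g: "\<And>N i. g N i \<in> borel_measurable seqM"
    and e: "\<And>N. e N \<in> borel_measurable seqM"
    and a: "\<And>N i u. u \<in> Ulam \<Longrightarrow> (\<integral>\<^sup>+ \<omega>. g N i (\<xi> \<omega> u) \<partial>M) = a N i"
    and b: "\<And>N u. u \<in> Ulam \<Longrightarrow> (\<integral>\<^sup>+ \<omega>. e N (\<xi> \<omega> u) \<partial>M) = b N"
    and r: "\<And>N. n0 \<le> N \<Longrightarrow> (\<Sum>i. a N (Suc i) * b (max N (Suc i))) \<le> ennreal r * b N"
    and r01: "0 \<le> r" "r < 1" and N: "n0 \<le> N" and fin: "b N < \<top>"
  shows "AE \<omega> in M. (\<Sum>m. pathsum g e (\<xi> \<omega>) m N []) < \<top>"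
proof -
  note [measurable] = measurable_pathsum [OF \<xi> g e]
  have "(\<integral>\<^sup>+ \<omega>. (\<Sum>m. pathsum g e (\<xi> \<omega>) m N []) \<partial>M) = (\<Sum>m. expected_pathsum a b m N)"
    using nn_integral_prod_pathsum [OF \<xi> ind g e a b g, of "{}" "[]"]
    by (subst nn_integral_suminf) (auto simp: Ulam_def)
  also have "\<dots> \<le> (\<Sum>m. ennreal (r ^ m) * b N)"
  proof (rule suminf_le)
    show "expected_pathsum a b m N \<le> ennreal (r ^ m) * b N" for m
      using expected_pathsum_le [of n0 a b "ennreal r", OF r N] r01 by (simp add: ennreal_power)
  qed auto
  also have "\<dots> = (\<Sum>m. ennreal (r ^ m)) * b N"
    by simp
  also have "(\<Sum>m. ennreal (r ^ m)) = ennreal (1 / (1 - r))"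
    using r01 by (subst suminf_ennreal2) (auto simp: suminf_geometric intro: summable_geometric)
  also have "\<dots> * b N < \<top>"
    using fin by (simp add: ennreal_mult_less_top)
  finally have "(\<integral>\<^sup>+ \<omega>. (\<Sum>m. pathsum g e (\<xi> \<omega>) m N []) \<partial>M) \<noteq> \<infinity>"
    by (auto simp: less_top)
  from nn_integral_PInf_AE [OF _ this] show ?thesis
    by (auto simp: less_top)
qed

section \<open>Infinite stars from the absence of explosive paths\<close>

abbreviation (input) waits :: "(nat list \<Rightarrow> ennreal) \<Rightarrow> nat list \<Rightarrow> nat \<Rightarrow> ennreal" where
  "waits X u \<equiv> (\<lambda>j. X (u @ [Suc j]))"

section \<open>Birth times along words\<close>

lemma snoc_in_Ulam_iff [simp]: "u @ [i] \<in> Ulam \<longleftrightarrow> u \<in> Ulam \<and> 0 < i"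
  by (auto simp: Ulam_def)

lemma Nil_in_Ulam [simp]: "[] \<in> Ulam"
  by (simp add: Ulam_def)

lemma birth_Nil [simp]: "birth X [] = 0"
  by (simp add: birth_def)

lemma birth_snoc: "birth X (u @ [i]) = birth X u + psum i (waits X u)"
proof -
  have "(\<Sum>l<length u. \<Sum>j=1..(u @ [i]) ! l. X (take l (u @ [i]) @ [j])) = birth X u"
    unfolding birth_def by (intro sum.cong) (auto simp: nth_append)
  moreover have "(\<Sum>j=1..i. X (u @ [j])) = psum i (waits X u)"
    unfolding psum_def by (simp add: sum.shift_bounds_Suc_ivl atLeast0LessThan [symmetric] sum.atLeast1_atMost_eq lessThan_Suc_atMost)
  ultimately show ?thesis by (simp add: birth_def)
qed

lemma birth_finite:
  assumes "\<And>u. u \<in> Ulam \<Longrightarrow> (\<Sum>i. waits X u i) < \<top>" and "x \<in> Ulam"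
  shows "birth X x < \<top>"
  using assms(2)
proof (induction x rule: rev_induct)
  case (snoc i u)
  then show ?case
    using assms(1) [of u] psum_le_suminf [of i "waits X u"] by (auto simp: birth_snoc)
qed simp

text \<open>Konig's lemma: follow words that have infinitely many continuations in
  \<open>D\<close>.\<close>

lemma konig_words:
  fixes D :: "'b list set"
  assumes inf: "infinite D" and closed: "\<And>u i. u @ [i] \<in> D \<Longrightarrow> u \<in> D"
    and fin: "\<And>u. u \<in> D \<Longrightarrow> finite {i. u @ [i] \<in> D}"
  obtains p where "p 0 = []" "\<And>k. p k \<in> D" "\<And>k. \<exists>i. p (Suc k) = p k @ [i]"
proof -
  define Q where "Q u \<longleftrightarrow> infinite {v. u @ v \<in> D}" for u
  have pre: "u \<in> D" if "u @ v \<in> D" for u v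
    using that closed by (induction v rule: rev_induct) (auto simp flip: append_assoc)
  have QD: "u \<in> D" if "Q u" for u
    using that infinite_imp_nonempty pre unfolding Q_def by blast
  have step: "\<exists>u'. Q u' \<and> (\<exists>i. u' = u @ [i])" if "Q u" for u
  proof (rule ccontr)
    assume no: "\<not> ?thesis"
    \<comment> \<open>A continuation is empty or passes through one of the finitely many children in
      \<open>D\<close>, so some child inherits infinitely many.\<close>
    have "{v. u @ v \<in> D} \<subseteq> insert [] (\<Union>i\<in>{i. u @ [i] \<in> D}. (#) i ` {v. (u @ [i]) @ v \<in> D})"
    proof
      fix v assume v: "v \<in> {v. u @ v \<in> D}"
      show "v \<in> insert [] (\<Union>i\<in>{i. u @ [i] \<in> D}. (#) i ` {v. (u @ [i]) @ v \<in> D})"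
      proof (cases v)
        case (Cons i w)
        with v have "(u @ [i]) @ w \<in> D" by simp
        with pre [OF this] Cons show ?thesis by auto
      qed simp
    qed
    moreover have "finite (insert [] (\<Union>i\<in>{i. u @ [i] \<in> D}. (#) i ` {v. (u @ [i]) @ v \<in> D}))"
    proof (intro finite.insertI finite_UN_I finite_imageI)
      show "finite {i. u @ [i] \<in> D}" by (rule fin [OF QD [OF that]])
      show "finite {v. (u @ [i]) @ v \<in> D}" for i
        using no unfolding Q_def by blast
    qed
    ultimately show False
      using that finite_subset unfolding Q_def by blast
  qed
  obtain p where "p 0 = []" "\<And>k. Q (p k)" "\<And>k. \<exists>i. p (Suc k) = p k @ [i]"
    using dependent_nat_choice [of "\<lambda>n u. Q u \<and> (n = 0 \<longrightarrow> u = [])" "\<lambda>n u u'. \<exists>i. u' = u @ [i]"]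
      step inf by (auto simp: Q_def)
  then show ?thesis using that QD by blast
qed

section \<open>Individuals born before the limit of the \<open>tau\<close> times\<close>

lemma tau_le_if_infinite_born:
  "infinite (born X t) \<Longrightarrow> tau X k \<le> t"
  unfolding tau_def by (intro Inf_lower) (simp add: ecard_def)

text \<open>Strictness yields a \<open>k\<close> such that fewer than \<open>k\<close> individuals
  are born up to the birth time of \<open>x\<close>. All predecessors of \<open>x\<close> under
  \<open>birth_less\<close> are among them, so the rank of \<open>x\<close> is below
  \<open>k\<close>.\<close>

lemma less_SUP_tau_imp_in_Tinf:
  assumes "x \<in> Ulam" and lt: "birth X x < (SUP k. tau X k)"
  shows "x \<in> Tinf X"
proof -
  obtain k where k: "birth X x < tau X k"
    using lt by (auto simp: less_SUP_iff)
  let ?B = "born X (birth X x)"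
  have "\<not> enat k \<le> ecard ?B"
  proof
    assume "enat k \<le> ecard ?B"
    then have "tau X k \<le> birth X x"
      unfolding tau_def by (intro Inf_lower) simp
    with k show False by simp
  qed
  then have fin: "finite ?B" "card ?B < k"
    by (auto simp: ecard_def split: if_splits)
  let ?C = "{y \<in> born X (tau X k). birth_less X y x}"
  have "?C \<subseteq> ?B"
    by (auto simp: born_def birth_less_def)
  then have "finite ?C" "card ?C < k"
    using fin card_mono finite_subset by (blast, meson le_less_trans card_mono)
  then have "x \<in> first_tree X k"
    using k assms(1) by (auto simp: first_tree_def Let_def born_def less_imp_le)
  then show ?thesis by (auto simp: Tinf_def)
qed

text \<open>A purely deterministic statement. The individuals born by the limit \<open>T\<close> of
  the \<open>tau\<close> times form an infinite tree \<open>D\<close>. Either some node has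
  infinitely many children in \<open>D\<close>, or Konig's lemma gives a path excluded by
  \<open>nopath\<close>.\<close>

lemma infinite_star_if_no_explosive_path:
  assumes fin: "\<And>u. u \<in> Ulam \<Longrightarrow> (\<Sum>i. waits X u i) < \<top>"
    and pos: "\<And>u n. u \<in> Ulam \<Longrightarrow> 1 \<le> n \<Longrightarrow> 0 < tsum n (waits X u)"
    and nopath: "\<And>p t. p 0 = [] \<Longrightarrow> (\<And>k. \<exists>i>0. p (Suc k) = p k @ [i]) \<Longrightarrow> t < \<top> \<Longrightarrow>
      (\<And>k. birth X (p k) \<le> t) \<Longrightarrow> (\<And>k. t < birth X (p k) + (\<Sum>i. waits X (p k) i)) \<Longrightarrow> False"
  shows "\<exists>u\<in>Tinf X. infinite {i. u @ [i] \<in> Tinf X}"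
proof -
  define T where "T = (SUP k. tau X k)"
  define D where "D = born X T"
  note bfin = birth_finite [of X, OF fin]
  have in_D: "x \<in> D \<longleftrightarrow> x \<in> Ulam \<and> birth X x \<le> T" for x
    using bfin [of x] by (auto simp: D_def born_def)
  have mono: "birth X (u @ [i]) \<le> birth X (u @ [j])" if "i \<le> j" for u i j
    using psum_mono [OF that] by (simp add: birth_snoc add_left_mono)
  have step: "birth X u \<le> birth X (u @ [i])" for u i
    by (simp add: birth_snoc)
  have child: "birth X (u @ [i]) \<le> birth X u + (\<Sum>i. waits X u i)" for u i
    using psum_le_suminf by (simp add: birth_snoc add_left_mono)
  \<comment> \<open>By the time on the right all infinitely many children of \<open>u\<close> are
    born, so every \<open>tau X k\<close> has been reached.\<close>
  have T_le: "T \<le> birth X u + (\<Sum>i. waits X u i)" if u: "u \<in> Ulam" for u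
    unfolding T_def
  proof (intro SUP_least tau_le_if_infinite_born)
    have "(\<lambda>i. u @ [Suc i]) ` UNIV \<subseteq> born X (birth X u + (\<Sum>i. waits X u i))"
      using u child bfin [of "u @ [Suc i]" for i] by (auto simp: born_def less_top)
    moreover have "infinite ((\<lambda>i. u @ [Suc i]) ` UNIV)"
      by (rule range_inj_infinite) (auto simp: inj_def)
    ultimately show "infinite (born X (birth X u + (\<Sum>i. waits X u i)))"
      by (rule infinite_super)
  qed
  have T_fin: "T < \<top>"
    using T_le [of "[]"] fin [of "[]"] by (auto intro: le_less_trans)
  have Nil: "[] \<in> D" by (simp add: in_D)
  have closed: "u \<in> D" if "u @ [i] \<in> D" for u i
    using that step [of u i] by (auto simp: in_D intro: order_trans)
  \<comment> \<open>If \<open>D\<close> were finite, an interval after \<open>T\<close> would be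
    free of births, and some \<open>tau\<close> value would exceed \<open>T\<close>.\<close>
  have infD: "infinite D"
  proof
    assume finD: "finite D"
    have "\<exists>i>0. T < birth X (u @ [i])" if "u \<in> D" for u
    proof (rule ccontr)
      assume "\<not> ?thesis"
      then have "(\<lambda>i. u @ [Suc i]) ` UNIV \<subseteq> D"
        using that by (auto simp: in_D not_less)
      moreover have "infinite ((\<lambda>i. u @ [Suc i]) ` UNIV)"
        by (rule range_inj_infinite) (auto simp: inj_def)
      ultimately show False using finD finite_subset by blast
    qed
    then obtain e where e: "\<And>u. u \<in> D \<Longrightarrow> 0 < e u \<and> T < birth X (u @ [e u])"
      by metis
    \<comment> \<open>End of the birth-free interval: the earliest birth after \<open>T\<close>
      among children of members of \<open>D\<close>. As birth times increase with the label, the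
      first late child of each member suffices.\<close>
    define t where "t = Min ((\<lambda>u. birth X (u @ [(LEAST i. T < birth X (u @ [i]))])) ` D)"
    have "T < t"
      unfolding t_def using finD Nil LeastI [of "\<lambda>i. T < birth X (u @ [i])" "e u" for u] e
      by (subst Min_gr_iff) auto
    then obtain s where s: "T < s" "s < t" using dense by blast
    have sub: "x \<in> D" if "x \<in> Ulam" "birth X x < t" for x
      using that
    proof (induction x rule: rev_induct)
      case Nil
      then show ?case using \<open>[] \<in> D\<close> by simp
    next
      case (snoc i u)
      then have u: "u \<in> D"
        using step [of u i] by auto
      define l where "l = (LEAST i. T < birth X (u @ [i]))"
      have "t \<le> birth X (u @ [l])"
        unfolding t_def l_def using finD u by (intro Min_le) auto
      then have "i < l"
        using snoc.prems mono [of l i u] by (metis leD leI order.strict_trans2)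
      then have "\<not> T < birth X (u @ [i])"
        unfolding l_def by (rule not_less_Least)
      then show ?case using snoc.prems by (simp add: in_D)
    qed
    have "s \<le> tau X (Suc (card D))"
      unfolding tau_def
    proof (rule Inf_greatest, rule ccontr)
      fix t' assume t': "t' \<in> {t. enat (Suc (card D)) \<le> ecard (born X t)}" and "\<not> s \<le> t'"
      then have "born X t' \<subseteq> D"
        using s sub by (auto simp: born_def)
      then have "finite (born X t')" "card (born X t') \<le> card D"
        using finD finite_subset card_mono by blast+
      then show False using t' by (simp add: ecard_def)
    qed
    also have "\<dots> \<le> T" unfolding T_def by (rule SUP_upper) simp
    finally show False using s by simp
  qed
  show ?thesis
  proof (cases "\<exists>u\<in>D. infinite {i. u @ [i] \<in> D}")
    case True
    then obtain u where u: "u \<in> D" "infinite {i. u @ [i] \<in> D}" by blast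
    have all: "birth X (u @ [i]) \<le> T" for i
    proof -
      obtain j where "i \<le> j" "u @ [j] \<in> D"
        using u(2) unfolding infinite_nat_iff_unbounded_le by auto
      then show ?thesis using mono [of i j u] by (auto simp: in_D)
    qed
    \<comment> \<open>All children of \<open>u\<close> are born by \<open>T\<close>, so the supremum
      of their birth times is at most \<open>T\<close>. The positive waiting time left after child
      \<open>i\<close> makes the inequality strict, as membership in \<open>Tinf\<close> demands
      here.\<close>
    have lt: "birth X (u @ [i]) < T" if "0 < i" for i
    proof -
      have "psum i (waits X u) < \<top>"
        using fin [of u] u psum_le_suminf [of i "waits X u"] by (auto simp: in_D)
      moreover have "birth X u < \<top>" using u bfin by (auto simp: in_D)
      ultimately have bt: "birth X (u @ [i]) < \<top>" by (simp add: birth_snoc)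
      have "birth X (u @ [i]) < birth X (u @ [i]) + tsum i (waits X u)"
        using pos [of u i] u that bt ennreal_add_left_cancel_less [of "birth X (u @ [i])" 0 "tsum i (waits X u)"]
        by (simp add: in_D)
      also have "\<dots> = birth X u + (\<Sum>i. waits X u i)"
        by (simp add: birth_snoc add.assoc psum_plus_tsum)
      also have "\<dots> = (SUP n. birth X (u @ [n]))"
        unfolding suminf_eq_SUP birth_snoc psum_def
        by (rule ennreal_SUP_add_right) auto
      also have "\<dots> \<le> T" using all by (rule SUP_least)
      finally show ?thesis .
    qed
    have "u @ [i] \<in> Tinf X" if "0 < i" for i
      using less_SUP_tau_imp_in_Tinf lt [OF that] u that by (auto simp: in_D T_def)
    moreover have "u \<in> Tinf X"
      using less_SUP_tau_imp_in_Tinf [of u X] lt [of 1] step [of u 1] u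
      by (auto simp: in_D T_def)
    moreover have "infinite {i. 0 < (i::nat)}"
      using infinite_Ioi [of "0::nat"] by (simp add: greaterThan_def)
    ultimately show ?thesis
      using infinite_super [of "{i. 0 < i}" "{i. u @ [i] \<in> Tinf X}"] by blast
  next
    case False
    then have fin_children: "\<And>u. u \<in> D \<Longrightarrow> finite {i. u @ [i] \<in> D}" by blast
    obtain p where p: "p 0 = []" "\<And>k. p k \<in> D" "\<And>k. \<exists>i. p (Suc k) = p k @ [i]"
      by (rule konig_words [OF infD]) (erule closed, erule fin_children, blast)
    have 1: "\<exists>i>0. p (Suc k) = p k @ [i]" for k
      using p(3) [of k] p(2) [of "Suc k"] by (auto simp: in_D)
    \<comment> \<open>Otherwise every child of \<open>p k\<close> would be born by \<open>T\<close>,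
      against finite branching.\<close>
    have 2: "T < birth X (p k) + (\<Sum>i. waits X (p k) i)" for k
    proof (rule ccontr)
      assume "\<not> ?thesis"
      then have "birth X (p k @ [i]) \<le> T" for i
        using child [of "p k" i] by (simp add: not_less)
      then have "{0<..} \<subseteq> {i. p k @ [i] \<in> D}"
        using p(2) [of k] by (auto simp: in_D)
      then show False
        using False p(2) [of k] infinite_super infinite_Ioi by blast
    qed
    show ?thesis
      using nopath [OF p(1) 1 T_fin _ 2] p(2) by (auto simp: in_D)
  qed
qed

section \<open>Weights of explosive paths\<close>

text \<open>Take the step from a node with waiting times \<open>x\<close> to its \<open>i\<close>-th child. At a new record \<open>i > N\<close> the current
  node becomes the one whose explosion the path must precede: the factor \<open>exp_pos\<close> is the Chernoff
  weight of its remaining time to explosion. The cost of reaching the node's \<open>i\<close>-th child is lowered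
  to that of its \<open>N\<close>-th child; \<open>psum N x\<close> and \<open>tsum i x\<close> are then conditionally independent, and
  the factor \<open>exp_neg (lam N)\<close> pairs with the \<open>exp_pos (lam N)\<close> paid at the previous record,
  which gives the summands of Assumption A (2).\<close>

definition edge_weight :: "(nat \<Rightarrow> real) \<Rightarrow> nat \<Rightarrow> nat \<Rightarrow> (nat \<Rightarrow> ennreal) \<Rightarrow> ennreal" where
  "edge_weight lam N i x = (if i \<le> N then exp_neg (lam N) (psum i x)
     else exp_neg (lam N) (psum N x) * exp_pos (lam i) (tsum i x))"

section \<open>Lower bounds on the weight of a single path\<close>

primrec running_max :: "nat \<Rightarrow> (nat \<Rightarrow> nat) \<Rightarrow> nat \<Rightarrow> nat" where
  "running_max n c 0 = n"
| "running_max n c (Suc k) = max (running_max n c k) (c k)"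

lemma running_max_ge: "n \<le> running_max n c k"
  by (induction k) auto

lemma suminf_eq_top_if_infinitely_often_ge:
  fixes f :: "nat \<Rightarrow> ennreal"
  assumes inf: "infinite {k. \<epsilon> \<le> f k}" and "0 < \<epsilon>"
  shows "(\<Sum>k. f k) = \<top>"
proof -
  have "of_nat n * \<epsilon> \<le> (\<Sum>k. f k)" for n
  proof -
    obtain A where A: "finite A" "card A = n" "A \<subseteq> {k. \<epsilon> \<le> f k}"
      using infinite_arbitrarily_large [OF inf] by blast
    then have "of_nat n * \<epsilon> \<le> sum f A"
      using sum_bounded_below [of A \<epsilon> f] by auto
    also have "\<dots> \<le> (\<Sum>k. f k)"
      using A(1) by (intro sum_le_suminf) auto
    finally show ?thesis .
  qed
  then have "(SUP n. of_nat n * \<epsilon>) \<le> (\<Sum>k. f k)"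
    by (intro SUP_least)
  also have "(SUP n. of_nat n * \<epsilon>) = (SUP n. of_nat n) * \<epsilon>"
    by (simp add: SUP_mult_right_ennreal)
  also have "\<dots> = \<top>"
    using \<open>0 < \<epsilon>\<close> by (simp add: ennreal_SUP_of_nat_eq_top ennreal_top_mult)
  finally show ?thesis by (simp add: top_unique)
qed

text \<open>A single path is one nonnegative term of the sum over all paths. The offset
  \<open>j\<close> lets the induction follow \<open>pathsum\<close> in peeling off the first
  step.\<close>

lemma prod_le_pathsum:
  assumes p: "\<And>k. p (Suc k) = p k @ [c k]" and c: "\<And>k. 0 < c k"
  shows "(\<Prod>l<k. g (running_max n c (j + l)) (c (j + l)) (\<xi> (p (j + l)))) * e (running_max n c (j + k)) (\<xi> (p (j + k)))
    \<le> pathsum g e \<xi> k (running_max n c j) (p j)"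
proof (induction k arbitrary: j)
  case (Suc k)
  let ?f = "\<lambda>i. g (running_max n c j) (Suc i) (\<xi> (p j)) * pathsum g e \<xi> k (max (running_max n c j) (Suc i)) (p j @ [Suc i])"
  have "(\<Prod>l<Suc k. g (running_max n c (j + l)) (c (j + l)) (\<xi> (p (j + l)))) * e (running_max n c (j + Suc k)) (\<xi> (p (j + Suc k)))
    = g (running_max n c j) (c j) (\<xi> (p j)) *
      ((\<Prod>l<k. g (running_max n c (Suc j + l)) (c (Suc j + l)) (\<xi> (p (Suc j + l)))) * e (running_max n c (Suc j + k)) (\<xi> (p (Suc j + k))))"
    by (subst prod.lessThan_Suc_shift) (simp add: mult.assoc)
  also have "\<dots> \<le> g (running_max n c j) (c j) (\<xi> (p j)) * pathsum g e \<xi> k (running_max n c (Suc j)) (p (Suc j))"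
    by (intro mult_left_mono Suc) simp
  \<comment> \<open>\<open>pathsum\<close> sums over labels \<open>Suc i\<close>, so label
    \<open>c j\<close> sits at index \<open>c j - 1\<close>.\<close>
  also have "\<dots> = ?f (c j - 1)"
    using c [of j] by (simp add: p)
  also have "\<dots> \<le> (\<Sum>i. ?f i)"
    using sum_le_suminf [of ?f "{c j - 1}"] by simp
  finally show ?case by simp
qed simp

text \<open>The invariant \<open>main\<close> says that the weight is at least
  \<open>exp (- lam n * t)\<close> times the exponential of the time left to the current deadline,
  scaled by the current rate. A step without record spends exactly its duration. A record spends at
  most the time left and starts afresh with the time left to the explosion of its own node. The
  second bound pays for child \<open>N\<close> just before a record.\<close>

lemma prod_edge_weight_ge:
  fixes X :: "nat list \<Rightarrow> ennreal" and lam :: "nat \<Rightarrow> real" and t :: real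
  assumes n: "1 \<le> n" and lam: "\<And>n. 1 \<le> n \<Longrightarrow> 0 < lam n"
    and fin: "\<And>u. u \<in> Ulam \<Longrightarrow> (\<Sum>i. waits X u i) < \<top>"
    and p: "p 0 = []" "\<And>k. p (Suc k) = p k @ [c k]" and c: "\<And>k. 0 < c k"
    and le: "\<And>k. birth X (p k) \<le> ennreal t" and t: "0 \<le> t"
    and less: "\<And>k. ennreal t < birth X (p k) + (\<Sum>i. waits X (p k) i)"
  defines "\<Phi> k \<equiv> (\<Prod>l<k. edge_weight lam (running_max n c l) (c l) (waits X (p l)))"
  shows "ennreal (exp (- lam n * t)) \<le> \<Phi> k"
    and "running_max n c k < c k \<Longrightarrow>
      ennreal (exp (- lam n * t)) \<le> \<Phi> k * exp_neg (lam (running_max n c k)) (psum (running_max n c k) (waits X (p k)))"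
proof -
  have U: "p k \<in> Ulam" for k
    by (induction k) (auto simp: p c)
  define B where "B k = enn2real (birth X (p k))" for k
  define s where "s k i = enn2real (psum i (waits X (p k)))" for k i
  define r where "r k i = enn2real (tsum i (waits X (p k)))" for k i
  have bfin: "birth X (p k) < \<top>" for k
    using birth_finite [of X, OF fin U] .
  have pfin: "psum i (waits X (p k)) < \<top>" and tfin: "tsum i (waits X (p k)) < \<top>" for k i
    using psum_le_suminf tsum_le_suminf fin [OF U [of k]] le_less_trans by blast+
  have birth: "birth X (p k) = ennreal (B k)" and psum: "psum i (waits X (p k)) = ennreal (s k i)"
    and tsum: "tsum i (waits X (p k)) = ennreal (r k i)" for k i
    using bfin pfin tfin by (simp_all add: B_def s_def r_def)
  have nonneg: "0 \<le> B k" "0 \<le> s k i" "0 \<le> r k i" for k i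
    by (simp_all add: B_def s_def r_def)
  have B_Suc: "B (Suc k) = B k + s k (c k)" for k
    using birth_snoc [of X "p k" "c k"] birth [of "Suc k"] nonneg
    by (simp add: p(2) [symmetric] birth psum flip: ennreal_plus)
  have B_le: "B k \<le> t" for k
    using le [of k] t by (simp add: birth)
  have total: "t < B k + s k i + r k i" for k i
    using less [of k] t nonneg
    by (simp add: birth psum tsum psum_plus_tsum [symmetric, of _ i] ennreal_less_iff add.assoc flip: ennreal_plus)
  have s_mono: "s k i \<le> s k j" if "i \<le> j" for k i j
    using psum_mono [OF that, of "waits X (p k)"] nonneg by (simp add: psum)
  \<comment> \<open>Deadline: the explosion time of the node at which the last record occurred (\<open>t\<close> before the first one).\<close>
  define d where "d = rec_nat t (\<lambda>k d. if c k \<le> running_max n c k then d else B k + s k (c k) + r k (c k))"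
  have d_0: "d 0 = t" and d_Suc: "d (Suc k) = (if c k \<le> running_max n c k then d k else B k + s k (c k) + r k (c k))" for k
    by (simp_all add: d_def)
  have d_ge: "t \<le> d k" for k
    using total by (induction k) (auto simp: d_0 d_Suc less_imp_le)
  have lam_pos: "0 < lam (running_max n c k)" for k
    using lam n running_max_ge [of n c k] by (meson le_trans)
  have neg: "exp_neg l (psum i (waits X (p k))) = ennreal (exp (- l * s k i))" for l k i
    using nonneg by (simp add: exp_neg_def psum)
  have pos: "exp_pos l (tsum i (waits X (p k))) = ennreal (exp (l * r k i))" for l k i
    using nonneg by (simp add: exp_pos_def tsum)
  \<comment> \<open>At a record, child \<open>N\<close> is born no later than child
    \<open>c k\<close>, which is born by \<open>t\<close> and hence by the deadline.\<close>
  have jump: "lam (running_max n c k) * s k (running_max n c k) \<le> lam (running_max n c k) * (d k - B k)" if "running_max n c k < c k" for k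
  proof (rule mult_left_mono)
    show "s k (running_max n c k) \<le> d k - B k"
      using s_mono [of "running_max n c k" "c k" k] that B_Suc [of k] B_le [of "Suc k"] d_ge [of k] by linarith
  qed (use lam_pos less_imp_le in blast)
  have main: "ennreal (exp (- lam n * t + lam (running_max n c k) * (d k - B k))) \<le> \<Phi> k" for k
  proof (induction k)
    \<comment> \<open>At the root the deadline is \<open>t\<close>, the rate \<open>lam n\<close>
      and the birth time 0, so the exponent vanishes.\<close>
    case 0
    then show ?case by (simp add: \<Phi>_def d_0 B_def p)
  next
    case (Suc k)
    let ?N = "running_max n c k"
    have "ennreal (exp (- lam n * t + lam (running_max n c (Suc k)) * (d (Suc k) - B (Suc k))))
       \<le> ennreal (exp (- lam n * t + lam ?N * (d k - B k))) * edge_weight lam ?N (c k) (waits X (p k))"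
    proof (cases "c k \<le> ?N")
      case True
      then show ?thesis
        by (simp add: edge_weight_def neg d_Suc B_Suc max_absorb1 algebra_simps flip: ennreal_mult exp_add)
    next
      case False
      then have "max ?N (c k) = c k" by simp
      then show ?thesis
        using False jump [of k]
        by (simp add: edge_weight_def neg pos d_Suc B_Suc algebra_simps flip: ennreal_mult exp_add)
    qed
    also have "\<dots> \<le> \<Phi> k * edge_weight lam ?N (c k) (waits X (p k))"
      by (intro mult_right_mono Suc) simp
    finally show ?case by (simp add: \<Phi>_def)
  qed
  have "- lam n * t \<le> - lam n * t + lam (running_max n c k) * (d k - B k)"
    using lam_pos [of k] d_ge [of k] B_le [of k] by simp
  then show "ennreal (exp (- lam n * t)) \<le> \<Phi> k"
    using main [of k] order_trans by (meson ennreal_leI exp_le_cancel_iff)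
  assume *: "running_max n c k < c k"
  have "ennreal (exp (- lam n * t))
     \<le> ennreal (exp (- lam n * t + lam (running_max n c k) * (d k - B k))) * ennreal (exp (- lam (running_max n c k) * s k (running_max n c k)))"
    using jump [OF *] by (simp flip: ennreal_mult exp_add)
  also have "\<dots> \<le> \<Phi> k * ennreal (exp (- lam (running_max n c k) * s k (running_max n c k)))"
    by (intro mult_right_mono main) simp
  finally show "ennreal (exp (- lam n * t)) \<le> \<Phi> k * exp_neg (lam (running_max n c k)) (psum (running_max n c k) (waits X (p k)))"
    by (simp only: neg)
qed

text \<open>The two final weights serve two cases. If the labels are bounded, a start above the
  bound meets no record, and the constant weight \<open>b N\<close> keeps all terms away from 0. If
  not, \<open>b\<close> may decay along the path, but records recur forever, and before each of them
  the weight with \<open>exp_neg\<close> is bounded below.\<close>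

lemma no_explosive_path:
  fixes X :: "nat list \<Rightarrow> ennreal" and lam :: "nat \<Rightarrow> real" and t :: ennreal
  assumes n: "1 \<le> n0" and lam: "\<And>n. 1 \<le> n \<Longrightarrow> 0 < lam n"
    and fin: "\<And>u. u \<in> Ulam \<Longrightarrow> (\<Sum>i. waits X u i) < \<top>"
    and b: "\<And>N. n0 \<le> N \<Longrightarrow> 0 < b N"
    and sum_const: "\<And>N. n0 \<le> N \<Longrightarrow> (\<Sum>m. pathsum (edge_weight lam) (\<lambda>N _. b N) (waits X) m N []) < \<top>"
    and sum_exp: "\<And>N. n0 \<le> N \<Longrightarrow>
      (\<Sum>m. pathsum (edge_weight lam) (\<lambda>N x. exp_neg (lam N) (psum N x)) (waits X) m N []) < \<top>"
    and p: "p 0 = []" "\<And>k. \<exists>i>0. p (Suc k) = p k @ [i]" and t: "t < \<top>"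
    and le: "\<And>k. birth X (p k) \<le> t"
    and less: "\<And>k. t < birth X (p k) + (\<Sum>i. waits X (p k) i)"
  shows False
proof -
  obtain c where c: "\<And>k. 0 < c k" "\<And>k. p (Suc k) = p k @ [c k]"
    using p(2) by metis
  define t' where "t' = enn2real t"
  have t': "t = ennreal t'" "0 \<le> t'" using t by (simp_all add: t'_def)
  note ge = prod_edge_weight_ge [OF _ lam fin p(1) c(2,1) le [unfolded t'] t'(2) less [unfolded t']]
  have path: "(\<Prod>l<k. edge_weight lam (running_max N c l) (c l) (waits X (p l)))
      * e (running_max N c k) (waits X (p k)) \<le> pathsum (edge_weight lam) e (waits X) k N []" for N k e
    using prod_le_pathsum [where p = p and c = c and j = 0 and n = N and g = "edge_weight lam" and e = e
        and \<xi> = "waits X" and k = k, OF c(2,1)] by (simp add: p(1))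
  show False
  proof (cases "\<exists>K. \<forall>k. c k \<le> K")
    case True
    then obtain K where K: "\<And>k. c k \<le> K" by blast
    define N where "N = max n0 K"
    have N: "1 \<le> N" "n0 \<le> N" using n by (auto simp: N_def)
    have rec: "running_max N c k = N" for k
    proof (induction k)
      case (Suc k)
      then show ?case using K [of k] by (simp add: N_def max_absorb1 le_max_iff_disj)
    qed simp
    have "ennreal (exp (- lam N * t')) * b N \<le> pathsum (edge_weight lam) (\<lambda>N _. b N) (waits X) k N []" for k
      using order_trans [OF mult_right_mono [OF ge(1) [OF N(1)]] path [of N k "\<lambda>N _. b N"]]
      by (simp add: rec)
    then have "infinite {k. ennreal (exp (- lam N * t')) * b N \<le> pathsum (edge_weight lam) (\<lambda>N _. b N) (waits X) k N []}"
      by simp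
    moreover have "0 < ennreal (exp (- lam N * t')) * b N"
      using b [OF N(2)] by (simp add: ennreal_zero_less_mult_iff)
    ultimately show False
      using suminf_eq_top_if_infinitely_often_ge sum_const [OF N(2)] by fastforce
  next
    case False
    \<comment> \<open>With finitely many records the running maximum would freeze and bound all
      labels.\<close>
    have "infinite {k. running_max n0 c k < c k}"
    proof
      assume "finite {k. running_max n0 c k < c k}"
      then obtain m where m: "\<And>k. m \<le> k \<Longrightarrow> c k \<le> running_max n0 c k"
        unfolding finite_nat_set_iff_bounded_le by (metis mem_Collect_eq not_less not_less_eq_eq)
      have *: "running_max n0 c (m + k) = running_max n0 c m" for k
      proof (induction k)
        case (Suc k)
        then show ?case using m [of "m + k"] by (simp add: max_absorb1)
      qed simp
      have "c k \<le> Max (insert (running_max n0 c m) (c ` {..<m}))" for k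
      proof (cases "k < m")
        case False
        then have "c k \<le> running_max n0 c m" using m [of k] * [of "k - m"] by simp
        also have "\<dots> \<le> Max (insert (running_max n0 c m) (c ` {..<m}))" by (rule Max_ge) auto
        finally show ?thesis .
      qed simp
      then show False using False by blast
    qed
    moreover have "{k. running_max n0 c k < c k} \<subseteq> {k. ennreal (exp (- lam n0 * t'))
        \<le> pathsum (edge_weight lam) (\<lambda>N x. exp_neg (lam N) (psum N x)) (waits X) k n0 []}"
      using order_trans [OF ge(2) [OF n] path [of n0 _ "\<lambda>N x. exp_neg (lam N) (psum N x)"]] by blast
    ultimately have "infinite {k. ennreal (exp (- lam n0 * t'))
        \<le> pathsum (edge_weight lam) (\<lambda>N x. exp_neg (lam N) (psum N x)) (waits X) k n0 []}"
      using infinite_super by blast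
    then show False
      using suminf_eq_top_if_infinitely_often_ge sum_exp [of n0] by fastforce
  qed
qed

section \<open>Contraction of the expected weights\<close>

lemma ennreal_suminf_tail_less:
  fixes f :: "nat \<Rightarrow> ennreal"
  assumes fin: "(\<Sum>i. f i) < \<top>" and d: "0 < d"
  obtains K where "(\<Sum>i. f (i + K)) < d"
proof -
  have "(\<lambda>K. sum f {..<K}) \<longlonglongrightarrow> (\<Sum>i. f i)"
    by (rule summable_LIMSEQ) auto
  then have "(\<lambda>K. (\<Sum>i. f i) - sum f {..<K}) \<longlonglongrightarrow> (\<Sum>i. f i) - (\<Sum>i. f i)"
    using fin by (intro tendsto_diff_ennreal tendsto_const) auto
  moreover have "(\<Sum>i. f i) - sum f {..<K} = (\<Sum>i. f (i + K))" for K
  proof -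
    have split: "(\<Sum>i. f i) = sum f {..<K} + (\<Sum>i. f (i + K))"
      using suminf_offset [of f K] by simp
    then have "sum f {..<K} < \<top>"
      using fin by (auto simp: less_top)
    then have "sum f {..<K} \<noteq> \<infinity>" by (metis infinity_ennreal_def less_irrefl)
    then show ?thesis unfolding split by (subst add.commute) (rule ennreal_add_diff_cancel)
  qed
  ultimately have "(\<lambda>K. (\<Sum>i. f (i + K))) \<longlonglongrightarrow> 0"
    using fin by (simp add: less_top)
  from order_tendstoD(2) [OF this d] that show ?thesis
    by (auto simp: eventually_sequentially)
qed

lemma tendsto_exp_neg:
  assumes "filterlim l at_top F"
  shows "((\<lambda>n. exp_neg (l n) z) \<longlongrightarrow> (if z = 0 then 1 else 0)) F"
proof (cases z)
  case (real r)
  show ?thesis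
  proof (cases "r = 0")
    case False
    with real have "0 < r" by simp
    then have "filterlim (\<lambda>n. r * l n) at_top F"
      using assms by (intro filterlim_tendsto_pos_mult_at_top [OF tendsto_const])
    then have "((\<lambda>n. exp (- (r * l n))) \<longlongrightarrow> 0) F"
      by (intro filterlim_compose [OF exp_at_bot]) (simp add: filterlim_uminus_at_bot)
    then have "((\<lambda>n. ennreal (exp (- (r * l n)))) \<longlongrightarrow> ennreal 0) F"
      by (rule tendsto_ennrealI)
    then show ?thesis
      using real \<open>0 < r\<close> by (simp add: exp_neg_def mult.commute)
  qed (use real in \<open>simp add: exp_neg_def\<close>)
qed (simp add: exp_neg_def)

text \<open>If the first \<open>i + 1\<close> waiting times vanish, so does \<open>x i\<close>. The
  number of such \<open>i\<close> is at most one more than the largest of them, and this is the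
  label of a child with zero waiting time.\<close>

lemma sum_psum_eq_0_le_Sup:
  "(\<Sum>i<K. if psum (Suc i) x = 0 then 1 else 0 :: ennreal) \<le> Sup {of_nat (Suc j) | j. x j = 0}"
proof -
  define A where "A = {i. i < K \<and> psum (Suc i) x = 0}"
  have "finite A" by (simp add: A_def)
  have "(\<Sum>i<K. if psum (Suc i) x = 0 then 1 else 0 :: ennreal) = of_nat (card A)"
    using sum.inter_filter [of "{..<K}" "\<lambda>_. 1 :: ennreal" "\<lambda>i. psum (Suc i) x = 0", symmetric]
    by (simp add: A_def)
  also have "\<dots> \<le> Sup {of_nat (Suc j) | j. x j = 0}"
  proof (cases "A = {}")
    case False
    with \<open>finite A\<close> have "Max A \<in> A" by simp
    then have "psum (Suc (Max A)) x = 0" unfolding A_def by blast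
    then have "x (Max A) = 0" by (simp add: psum_def)
    then have "of_nat (Suc (Max A)) \<le> Sup {of_nat (Suc j) :: ennreal | j. x j = 0}"
      by (intro Sup_upper CollectI exI [of _ "Max A"] conjI refl)
    moreover have "card A \<le> card {..Max A}"
      using \<open>finite A\<close> by (intro card_mono) auto
    then have "(of_nat (card A) :: ennreal) \<le> of_nat (Suc (Max A))"
      by (simp only: card_atMost of_nat_le_iff)
    ultimately show ?thesis by (rule order_trans [rotated])
  qed simp
  finally show ?thesis .
qed

text \<open>A factor \<open>L N\<close> splits off each term: without record the state remains
  \<open>N\<close>, and at a record \<open>jump\<close> supplies it. For labels up to
  \<open>K\<close> the remaining costs have a limit in \<open>N\<close> of total at most the
  expectation in \<open>zero\<close>; beyond \<open>K\<close> they are bounded by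
  \<open>E i * L i\<close>, with small sum.\<close>

lemma (in prob_space) edge_weight_contraction:
  fixes x :: "'a \<Rightarrow> nat \<Rightarrow> ennreal" and lam :: "nat \<Rightarrow> real"
  assumes x [measurable]: "x \<in> M \<rightarrow>\<^sub>M seqM"
    and lam_pos: "\<And>n. 1 \<le> n \<Longrightarrow> 0 < lam n"
    and lam_mono: "\<And>m n. 1 \<le> m \<Longrightarrow> m \<le> n \<Longrightarrow> lam m \<le> lam n"
    and lam_lim: "filterlim lam at_top sequentially"
    and L: "\<And>N. L N = (\<integral>\<^sup>+ \<omega>. exp_neg (lam N) (psum N (x \<omega>)) \<partial>M)"
    and E: "\<And>n. 1 \<le> n \<Longrightarrow> 1 \<le> E n" and fin: "(\<Sum>n. E (Suc n) * L (Suc n)) < \<top>"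
    and jump: "\<And>N i. 1 \<le> N \<Longrightarrow> N < i \<Longrightarrow> (\<integral>\<^sup>+ \<omega>. edge_weight lam N i (x \<omega>) \<partial>M) \<le> L N * E i"
    and zero: "(\<integral>\<^sup>+ \<omega>. Sup {of_nat (Suc j) | j. x \<omega> j = 0} \<partial>M) < (1 :: ennreal)"
  obtains n0 r where "1 \<le> n0" "0 \<le> r" "r < 1"
    "\<And>N. n0 \<le> N \<Longrightarrow> (\<Sum>i. (\<integral>\<^sup>+ \<omega>. edge_weight lam N (Suc i) (x \<omega>) \<partial>M) * L (max N (Suc i))) \<le> ennreal r * L N"
proof -
  let ?s = "\<integral>\<^sup>+ \<omega>. Sup {of_nat (Suc j) :: ennreal | j. x \<omega> j = 0} \<partial>M"
  define s where "s = enn2real ?s"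
  have "?s < \<top>" using zero less_trans ennreal_one_less_top by blast
  then have s: "?s = ennreal s" "0 \<le> s" by (simp_all add: s_def)
  then have "s < 1" using zero by (simp add: ennreal_less_one_iff)
  \<comment> \<open>One \<open>d\<close> is spent on the tail beyond \<open>K\<close>, one on the
    limit in \<open>N\<close>; the third keeps the rate below 1.\<close>
  define d where "d = (1 - s) / 3"
  have d: "0 < d" "s + 2 * d < 1" using \<open>s < 1\<close> by (simp_all add: d_def field_simps)
  from d have "0 < ennreal d" by simp
  from ennreal_suminf_tail_less [OF fin this]
  obtain K where K: "(\<Sum>i. E (Suc (i + K)) * L (Suc (i + K))) < ennreal d" .
  define q where "q N i = (\<integral>\<^sup>+ \<omega>. exp_neg (lam N) (psum i (x \<omega>)) \<partial>M)" for N i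
  \<comment> \<open>The shift to \<open>Suc N\<close> is due to \<open>lam\<close> being known to be
    positive only from index 1 on.\<close>
  have q_lim: "(\<lambda>N. q (Suc N) i) \<longlonglongrightarrow> (\<integral>\<^sup>+ \<omega>. (if psum i (x \<omega>) = 0 then 1 else 0) \<partial>M)" for i
    unfolding q_def
  proof (rule nn_integral_dominated_convergence [where w = "\<lambda>_. 1"])
    show "AE \<omega> in M. exp_neg (lam (Suc N)) (psum i (x \<omega>)) \<le> 1" for N
      using exp_neg_le_1 lam_pos [of "Suc N"] by simp
    show "AE \<omega> in M. (\<lambda>N. exp_neg (lam (Suc N)) (psum i (x \<omega>))) \<longlonglongrightarrow> (if psum i (x \<omega>) = 0 then 1 else 0)"
      using tendsto_exp_neg [OF filterlim_compose [OF lam_lim filterlim_Suc]] by simp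
  qed (auto simp: emeasure_space_1)
  have "(\<lambda>N. \<Sum>i<K. q (Suc N) (Suc i)) \<longlonglongrightarrow> (\<Sum>i<K. \<integral>\<^sup>+ \<omega>. (if psum (Suc i) (x \<omega>) = 0 then 1 else 0) \<partial>M)"
    by (intro tendsto_sum q_lim)
  moreover have "(\<Sum>i<K. \<integral>\<^sup>+ \<omega>. (if psum (Suc i) (x \<omega>) = 0 then 1 else 0) \<partial>M) < ennreal (s + d)"
  proof -
    have "(\<Sum>i<K. \<integral>\<^sup>+ \<omega>. (if psum (Suc i) (x \<omega>) = 0 then 1 else 0) \<partial>M)
      = (\<integral>\<^sup>+ \<omega>. (\<Sum>i<K. if psum (Suc i) (x \<omega>) = 0 then 1 else 0) \<partial>M)"
      by (rule nn_integral_sum [symmetric]) measurable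
    also have "\<dots> \<le> ?s"
      by (intro nn_integral_mono sum_psum_eq_0_le_Sup)
    also have "\<dots> < ennreal (s + d)"
      using s d by (simp add: ennreal_less_iff)
    finally show ?thesis .
  qed
  ultimately have "eventually (\<lambda>N. (\<Sum>i<K. q (Suc N) (Suc i)) < ennreal (s + d)) sequentially"
    by (rule order_tendstoD(2))
  then obtain N0 where N0: "\<And>N. N0 \<le> N \<Longrightarrow> (\<Sum>i<K. q (Suc N) (Suc i)) < ennreal (s + d)"
    by (auto simp: eventually_sequentially)
  define n0 where "n0 = Suc (max N0 K)"
  have contract: "(\<Sum>i. (\<integral>\<^sup>+ \<omega>. edge_weight lam N (Suc i) (x \<omega>) \<partial>M) * L (max N (Suc i))) \<le> ennreal (s + 2 * d) * L N"
    if N: "n0 \<le> N" for N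
  proof -
    have N1: "1 \<le> N" "K \<le> N" using N by (auto simp: n0_def)
    define h where "h i = (if i \<le> N then q N i else E i * L i)" for i
    have term_le: "(\<integral>\<^sup>+ \<omega>. edge_weight lam N i (x \<omega>) \<partial>M) * L (max N i) \<le> L N * h i" if "1 \<le> i" for i
    proof (cases "i \<le> N")
      case True
      then show ?thesis by (simp add: h_def q_def edge_weight_def max_absorb1 mult.commute)
    next
      case False
      then have "(\<integral>\<^sup>+ \<omega>. edge_weight lam N i (x \<omega>) \<partial>M) * L i \<le> L N * E i * L i"
        using jump [OF N1(1), of i] by (intro mult_right_mono) auto
      with False show ?thesis by (simp add: h_def max_absorb2 mult.assoc)
    qed
    have N_pred: "N0 \<le> N - 1" "Suc (N - 1) = N" using N by (auto simp: n0_def)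
    have "(\<Sum>i<K. h (Suc i)) = (\<Sum>i<K. q N (Suc i))"
      using N1 by (intro sum.cong) (auto simp: h_def)
    also have "\<dots> \<le> ennreal (s + d)"
      using N0 [OF N_pred(1)] N_pred(2) by simp
    finally have head: "(\<Sum>i<K. h (Suc i)) \<le> ennreal (s + d)" .
    have "h (Suc (i + K)) \<le> E (Suc (i + K)) * L (Suc (i + K))" for i
    proof (cases "Suc (i + K) \<le> N")
      case True
      \<comment> \<open>The larger rate \<open>lam N\<close> only lowers the cost, so labels between
        \<open>K\<close> and \<open>N\<close> also fall under the summable tail.\<close>
      have "q N (Suc (i + K)) \<le> L (Suc (i + K))"
        unfolding q_def L using lam_mono [OF _ True] lam_pos [of "Suc (i + K)"]
        by (intro nn_integral_mono exp_neg_mono) auto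
      also have "\<dots> \<le> E (Suc (i + K)) * L (Suc (i + K))"
        using mult_right_mono [OF E, of "Suc (i + K)" "L (Suc (i + K))"] by simp
      finally show ?thesis using True by (simp add: h_def)
    qed (simp add: h_def)
    then have "(\<Sum>i. h (Suc (i + K))) \<le> (\<Sum>i. E (Suc (i + K)) * L (Suc (i + K)))"
      by (intro suminf_le) auto
    with K have tail: "(\<Sum>i. h (Suc (i + K))) \<le> ennreal d" by simp
    have "(\<Sum>i. h (Suc i)) = (\<Sum>i<K. h (Suc i)) + (\<Sum>i. h (Suc (i + K)))"
      using suminf_offset [of "\<lambda>i. h (Suc i)" K] by simp
    also have "\<dots> \<le> ennreal (s + d) + ennreal d"
      using head tail by (rule add_mono)
    also have "\<dots> = ennreal (s + 2 * d)"
      using s d by (simp flip: ennreal_plus)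
    finally have h_le: "(\<Sum>i. h (Suc i)) \<le> ennreal (s + 2 * d)" .
    have "(\<Sum>i. (\<integral>\<^sup>+ \<omega>. edge_weight lam N (Suc i) (x \<omega>) \<partial>M) * L (max N (Suc i))) \<le> (\<Sum>i. L N * h (Suc i))"
      using term_le
      by (intro suminf_le) auto
    also have "\<dots> = L N * (\<Sum>i. h (Suc i))" by simp
    also have "\<dots> \<le> L N * ennreal (s + 2 * d)"
      using h_le by (rule mult_left_mono) simp
    finally show ?thesis by (simp add: mult.commute)
  qed
  show ?thesis
  proof (rule that)
    show "1 \<le> n0" by (simp add: n0_def)
    show "0 \<le> s + 2 * d" "s + 2 * d < 1" using s d by simp_all
  qed (rule contract)
qed

section \<open>Existence of an infinite star\<close>

text \<open>Probability enters through countably many almost sure events: finite path sums for both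
  final weights and all starts from \<open>n0\<close> on, and at every node finite total and
  positive remaining waiting times. On their intersection the deterministic lemmas apply.\<close>

theorem mainTheorem1:
  fixes M :: "'a measure" and S :: "'s measure"
    and X :: "'a \<Rightarrow> nat list \<Rightarrow> ennreal" and W :: "'a \<Rightarrow> nat list \<Rightarrow> 's"
    and \<mu> :: "nat \<Rightarrow> 's \<Rightarrow> ennreal measure"
  assumes prob: "prob_space M"
    and X_meas: "\<And>u. (\<lambda>\<omega>. X \<omega> u) \<in> borel_measurable M"
    and W_meas: "\<And>u. (\<lambda>\<omega>. W \<omega> u) \<in> measurable M S"
    \<comment> \<open>the pairs ((X(uj))_{j>=1}, W_u), u in U, are independent ...\<close>
    and iid_indep: "prob_space.indep_vars M
         (\<lambda>_. (\<Pi>\<^sub>M j\<in>UNIV. (borel :: ennreal measure)) \<Otimes>\<^sub>M S)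
         (\<lambda>u \<omega>. ((\<lambda>j. X \<omega> (u @ [Suc j])), W \<omega> u)) Ulam"
    \<comment> \<open>... and identically distributed\<close>
    and iid_dist: "\<And>u. u \<in> Ulam \<Longrightarrow>
         distr M ((\<Pi>\<^sub>M j\<in>UNIV. (borel :: ennreal measure)) \<Otimes>\<^sub>M S)
               (\<lambda>\<omega>. ((\<lambda>j. X \<omega> (u @ [Suc j])), W \<omega> u))
       = distr M ((\<Pi>\<^sub>M j\<in>UNIV. (borel :: ennreal measure)) \<Otimes>\<^sub>M S)
               (\<lambda>\<omega>. ((\<lambda>j. X \<omega> [Suc j]), W \<omega> []))"
    \<comment> \<open>mu j w is the law of X_w(j+1); conditionally on W = w the X(i) are independent\<close>
    and mu_prob: "\<And>j w. w \<in> space S \<Longrightarrow> prob_space (\<mu> j w)"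
    and mu_sets: "\<And>j w. w \<in> space S \<Longrightarrow> sets (\<mu> j w) = sets borel"
    and mu_kernel: "\<And>j. \<mu> j \<in> S \<rightarrow>\<^sub>M prob_algebra borel"
    and cond_law: "\<And>A B. A \<in> sets (\<Pi>\<^sub>M j\<in>UNIV. (borel :: ennreal measure)) \<Longrightarrow> B \<in> sets S \<Longrightarrow>
         emeasure M {\<omega> \<in> space M. (\<lambda>j. X \<omega> [Suc j]) \<in> A \<and> W \<omega> [] \<in> B}
       = (\<integral>\<^sup>+ w. indicator B w * emeasure (\<Pi>\<^sub>M j\<in>UNIV. \<mu> j w) A \<partial>(distr M S (\<lambda>\<omega>. W \<omega> [])))"
    \<comment> \<open>Assumption A (1) and (2); nu n is the law of Y_n\<close>
    and A12: "\<exists>\<nu> :: nat \<Rightarrow> real measure.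
         (\<forall>n. prob_space (\<nu> n) \<and> sets (\<nu> n) = sets borel \<and> (AE y in \<nu> n. 0 < y)
              \<and> (\<integral>\<^sup>+ y. ennreal y \<partial>\<nu> n) < \<top>)
       \<and> (\<forall>w\<in>space S. \<forall>n. \<forall>t::real.
            emeasure (\<Pi>\<^sub>M j\<in>UNIV. \<mu> j w)
              {x \<in> space (\<Pi>\<^sub>M j\<in>UNIV. \<mu> j w). ennreal t < (\<Sum>i. x (n + i))}
            \<le> emeasure (\<nu> n) {y. t < y})
       \<and> (\<exists>lam :: nat \<Rightarrow> real.
            (\<forall>n\<ge>1. 0 < lam n) \<and> (\<forall>m n. 1 \<le> m \<longrightarrow> m \<le> n \<longrightarrow> lam m \<le> lam n)
          \<and> filterlim lam at_top sequentially
          \<and> (\<Sum>n. (\<integral>\<^sup>+ y. ennreal (exp (lam (Suc n) * y)) \<partial>\<nu> (Suc n))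
                 * (\<integral>\<^sup>+ w. (\<integral>\<^sup>+ x. exp_neg (lam (Suc n)) (\<Sum>j<Suc n. x j) \<partial>(\<Pi>\<^sub>M j\<in>UNIV. \<mu> j w))
                       \<partial>(distr M S (\<lambda>\<omega>. W \<omega> [])))) < \<top>)"
    \<comment> \<open>Assumption A (3)\<close>
    and A3a: "(\<integral>\<^sup>+ \<omega>. Sup {of_nat k | k. 1 \<le> k \<and> X \<omega> [k] = 0} \<partial>M) < (1 :: ennreal)"
    and A3b: "\<And>n. 1 \<le> n \<Longrightarrow> AE \<omega> in M. 0 < (\<Sum>i. X \<omega> [n + 1 + i])"
  shows "AE \<omega> in M. \<exists>u \<in> Tinf (X \<omega>). infinite {i. u @ [i] \<in> Tinf (X \<omega>)}"
proof -
  interpret prob_space M by (rule prob)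
  define \<xi> where "\<xi> \<omega> u = waits (X \<omega>) u" for \<omega> u
  define V where "V = distr M S (\<lambda>\<omega>. W \<omega> [])"
  define \<kappa> where "\<kappa> w = PiM UNIV (\<lambda>j. \<mu> j w)" for w
  have W_root [measurable]: "(\<lambda>\<omega>. W \<omega> []) \<in> M \<rightarrow>\<^sub>M S" by (rule W_meas)
  interpret V: prob_space V unfolding V_def by (rule prob_space_distr) measurable
  have sets_V [measurable_cong]: "sets V = sets S" and space_V: "space V = space S" by (simp_all add: V_def)
  have \<xi>_meas [measurable]: "(\<lambda>\<omega>. \<xi> \<omega> u) \<in> M \<rightarrow>\<^sub>M seqM" for u
    unfolding \<xi>_def by (rule measurable_PiM_single') (auto intro: X_meas simp: space_PiM)
  have \<xi>_ind: "indep_vars (\<lambda>_. seqM) (\<lambda>u \<omega>. \<xi> \<omega> u) Ulam"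
    using indep_vars_compose2 [OF iid_indep, of "\<lambda>_. fst" "\<lambda>_. seqM"] by (simp add: \<xi>_def)
  have \<kappa>: "\<kappa> \<in> S \<rightarrow>\<^sub>M prob_algebra seqM"
    unfolding \<kappa>_def [abs_def] by (rule measurable_PiM_kernel) (rule mu_kernel)
  have \<kappa>_sub: "\<kappa> \<in> V \<rightarrow>\<^sub>M subprob_algebra seqM"
    using measurable_prob_algebraD [OF \<kappa>] by (simp add: V_def)
  have \<kappa>_sets: "sets (\<kappa> w) = sets seqM" and \<kappa>_prob: "prob_space (\<kappa> w)" if "w \<in> space S" for w
    using measurable_space [OF \<kappa> that] by (auto simp: space_prob_algebra)
  \<comment> \<open>Each node has the law of the root by \<open>iid_dist\<close>, and
    \<open>cond_law\<close> disintegrates the root's law along its weight through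
    \<open>\<kappa>\<close>.\<close>
  have law: "(\<integral>\<^sup>+ \<omega>. h (\<xi> \<omega> u) \<partial>M) = (\<integral>\<^sup>+ w. \<integral>\<^sup>+ x. h x \<partial>\<kappa> w \<partial>V)"
    if u: "u \<in> Ulam" and h [measurable]: "h \<in> borel_measurable seqM" for h u
  proof -
    have pair: "(\<lambda>\<omega>. (\<xi> \<omega> u, W \<omega> u)) \<in> M \<rightarrow>\<^sub>M seqM \<Otimes>\<^sub>M S" for u
      using \<xi>_meas W_meas by measurable
    have dist: "distr M (seqM \<Otimes>\<^sub>M S) (\<lambda>\<omega>. (\<xi> \<omega> u, W \<omega> u)) = distr M (seqM \<Otimes>\<^sub>M S) (\<lambda>\<omega>. (\<xi> \<omega> [], W \<omega> []))"
      using iid_dist [OF u] by (simp add: \<xi>_def)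
    have "(\<integral>\<^sup>+ \<omega>. h (\<xi> \<omega> u) \<partial>M) = (\<integral>\<^sup>+ z. h (fst z) \<partial>distr M (seqM \<Otimes>\<^sub>M S) (\<lambda>\<omega>. (\<xi> \<omega> u, W \<omega> u)))"
      using pair [of u] by (subst nn_integral_distr) auto
    also have "\<dots> = (\<integral>\<^sup>+ \<omega>. h (\<xi> \<omega> []) \<partial>M)"
      unfolding dist using pair [of "[]"] by (subst nn_integral_distr) auto
    also have "\<dots> = (\<integral>\<^sup>+ x. h x \<partial>distr M seqM (\<lambda>\<omega>. \<xi> \<omega> []))"
      by (subst nn_integral_distr) auto
    also have "distr M seqM (\<lambda>\<omega>. \<xi> \<omega> []) = V \<bind> \<kappa>"
    proof (rule measure_eqI)
      show "sets (distr M seqM (\<lambda>\<omega>. \<xi> \<omega> [])) = sets (V \<bind> \<kappa>)"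
        using sets_bind [of V \<kappa> seqM] \<kappa>_sets V.not_empty by (simp add: space_V)
      fix A assume "A \<in> sets (distr M seqM (\<lambda>\<omega>. \<xi> \<omega> []))"
      then have A: "A \<in> sets seqM" by simp
      have "emeasure (distr M seqM (\<lambda>\<omega>. \<xi> \<omega> [])) A = emeasure M ((\<lambda>\<omega>. \<xi> \<omega> []) -` A \<inter> space M)"
        by (rule emeasure_distr [OF \<xi>_meas A])
      also have "\<dots> = emeasure M {\<omega> \<in> space M. (\<lambda>j. X \<omega> [Suc j]) \<in> A \<and> W \<omega> [] \<in> space S}"
        using measurable_space [OF W_root] by (intro arg_cong [where f = "emeasure M"]) (auto simp: \<xi>_def)
      also have "\<dots> = (\<integral>\<^sup>+ w. indicator (space S) w * emeasure (\<kappa> w) A \<partial>V)"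
        unfolding V_def \<kappa>_def by (rule cond_law [OF A]) simp
      also have "\<dots> = (\<integral>\<^sup>+ w. emeasure (\<kappa> w) A \<partial>V)"
        by (intro nn_integral_cong) (simp add: space_V)
      also have "\<dots> = emeasure (V \<bind> \<kappa>) A"
        by (rule emeasure_bind [OF V.not_empty \<kappa>_sub A, symmetric])
      finally show "emeasure (distr M seqM (\<lambda>\<omega>. \<xi> \<omega> [])) A = emeasure (V \<bind> \<kappa>) A" .
    qed
    also have "(\<integral>\<^sup>+ x. h x \<partial>(V \<bind> \<kappa>)) = (\<integral>\<^sup>+ w. \<integral>\<^sup>+ x. h x \<partial>\<kappa> w \<partial>V)"
      by (rule nn_integral_bind [OF h \<kappa>_sub])
    finally show ?thesis .
  qed
  obtain \<nu> where \<nu>_law: "\<forall>n. prob_space (\<nu> n) \<and> sets (\<nu> n) = sets borel \<and> (AE y in \<nu> n. 0 < (y::real))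
         \<and> (\<integral>\<^sup>+ y. ennreal y \<partial>\<nu> n) < \<top>"
    and \<nu>_dom: "\<forall>w\<in>space S. \<forall>n. \<forall>t::real.
         emeasure (\<Pi>\<^sub>M j\<in>UNIV. \<mu> j w) {x \<in> space (\<Pi>\<^sub>M j\<in>UNIV. \<mu> j w). ennreal t < (\<Sum>i. x (n + i))}
       \<le> emeasure (\<nu> n) {y. t < y}"
    and ex_lam: "\<exists>lam :: nat \<Rightarrow> real.
         (\<forall>n\<ge>1. 0 < lam n) \<and> (\<forall>m n. 1 \<le> m \<longrightarrow> m \<le> n \<longrightarrow> lam m \<le> lam n)
       \<and> filterlim lam at_top sequentially
       \<and> (\<Sum>n. (\<integral>\<^sup>+ y. ennreal (exp (lam (Suc n) * y)) \<partial>\<nu> (Suc n))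
              * (\<integral>\<^sup>+ w. (\<integral>\<^sup>+ x. exp_neg (lam (Suc n)) (\<Sum>j<Suc n. x j) \<partial>(\<Pi>\<^sub>M j\<in>UNIV. \<mu> j w))
                    \<partial>(distr M S (\<lambda>\<omega>. W \<omega> [])))) < \<top>"
    using A12 by (rule exE) (elim conjE, rule that)
  obtain lam :: "nat \<Rightarrow> real" where lam_all: "\<forall>n\<ge>1. 0 < lam n" "\<forall>m n. 1 \<le> m \<longrightarrow> m \<le> n \<longrightarrow> lam m \<le> lam n"
      "filterlim lam at_top sequentially"
    and sum: "(\<Sum>n. (\<integral>\<^sup>+ y. ennreal (exp (lam (Suc n) * y)) \<partial>\<nu> (Suc n))
        * (\<integral>\<^sup>+ w. \<integral>\<^sup>+ x. exp_neg (lam (Suc n)) (\<Sum>j<Suc n. x j) \<partial>(\<Pi>\<^sub>M j\<in>UNIV. \<mu> j w) \<partial>(distr M S (\<lambda>\<omega>. W \<omega> [])))) < \<top>"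
    using ex_lam by (elim exE conjE) (rule that)
  have \<nu>: "prob_space (\<nu> n)" "sets (\<nu> n) = sets borel" "AE y in \<nu> n. 0 < y" for n
    using \<nu>_law by simp_all
  have dom: "emeasure (\<kappa> w) {x \<in> space (\<kappa> w). ennreal t < tsum n x} \<le> emeasure (\<nu> n) {y. t < y}"
    if "w \<in> space S" for w n t
    using \<nu>_dom that by (simp add: \<kappa>_def tsum_def)
  have lam: "0 < lam n" if "1 \<le> n" for n
    using lam_all(1) that by simp
  have lam_mono: "lam m \<le> lam n" if "1 \<le> m" "m \<le> n" for m n
    using lam_all(2) that by simp
  \<comment> \<open>\<open>L N\<close> is the expected conditional Laplace transform of
    \<open>P_N\<close>, and \<open>E n\<close> the exponential moment of \<open>Y_n\<close>;
    \<open>E n * L n\<close> is the summand of Assumption A (2).\<close>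
  define L where "L N = (\<integral>\<^sup>+ w. \<integral>\<^sup>+ x. exp_neg (lam N) (psum N x) \<partial>\<kappa> w \<partial>V)" for N
  define E where "E n = (\<integral>\<^sup>+ y. ennreal (exp (lam n * y)) \<partial>\<nu> n)" for n
  have sum_EL: "(\<Sum>n. E (Suc n) * L (Suc n)) < \<top>"
    using sum by (simp only: E_def L_def \<kappa>_def V_def psum_def)
  have L: "(\<integral>\<^sup>+ \<omega>. exp_neg (lam N) (psum N (\<xi> \<omega> u)) \<partial>M) = L N" if "u \<in> Ulam" for N u
    unfolding L_def by (rule law [OF that]) measurable
  have L_fin: "L N < \<top>" if "1 \<le> N" for N
  proof -
    have "(\<integral>\<^sup>+ \<omega>. exp_neg (lam N) (psum N (\<xi> \<omega> [])) \<partial>M) \<le> (\<integral>\<^sup>+ \<omega>. 1 \<partial>M)"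
      using lam [OF that] by (intro nn_integral_mono exp_neg_le_1) simp
    then show ?thesis
      using L [of "[]" N] by (simp add: emeasure_space_1 le_less_trans [OF _ ennreal_one_less_top])
  qed
  have E_ge: "1 \<le> E n" if "1 \<le> n" for n
  proof -
    interpret N: prob_space "\<nu> n" by (rule \<nu>)
    have "(\<integral>\<^sup>+ y. 1 \<partial>\<nu> n) \<le> E n"
      unfolding E_def using \<nu>(3) [of n]
    proof (intro nn_integral_mono_AE, eventually_elim)
      case (elim y)
      then show ?case using lam [OF that] by (simp add: one_le_exp_iff mult_nonneg_nonneg less_imp_le)
    qed
    then show ?thesis by (simp add: N.emeasure_space_1)
  qed
  \<comment> \<open>Given the weight \<open>w\<close>, head and tail are independent, and domination
    by \<open>Y_i\<close> is uniform in \<open>w\<close>, so \<open>E i\<close> leaves the outer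
    integral.\<close>
  have jump: "(\<integral>\<^sup>+ \<omega>. edge_weight lam N i (\<xi> \<omega> []) \<partial>M) \<le> L N * E i" if "1 \<le> N" "N < i" for N i
  proof -
    have "(\<integral>\<^sup>+ \<omega>. edge_weight lam N i (\<xi> \<omega> []) \<partial>M)
        = (\<integral>\<^sup>+ \<omega>. exp_neg (lam N) (psum N (\<xi> \<omega> [])) * exp_pos (lam i) (tsum i (\<xi> \<omega> [])) \<partial>M)"
      using that by (simp add: edge_weight_def)
    also have "\<dots> = (\<integral>\<^sup>+ w. \<integral>\<^sup>+ x. exp_neg (lam N) (psum N x) * exp_pos (lam i) (tsum i x) \<partial>\<kappa> w \<partial>V)"
      by (rule law) (simp, measurable)
    also have "\<dots> \<le> (\<integral>\<^sup>+ w. (\<integral>\<^sup>+ x. exp_neg (lam N) (psum N x) \<partial>\<kappa> w) * E i \<partial>V)"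
    proof (rule nn_integral_mono)
      fix w assume "w \<in> space V"
      then have w: "w \<in> space S" by (simp add: space_V)
      have "(\<integral>\<^sup>+ x. exp_neg (lam N) (psum N x) * exp_pos (lam i) (tsum i x) \<partial>\<kappa> w)
          = (\<integral>\<^sup>+ x. exp_neg (lam N) (psum N x) \<partial>\<kappa> w) * (\<integral>\<^sup>+ x. exp_pos (lam i) (tsum i x) \<partial>\<kappa> w)"
        unfolding \<kappa>_def using that mu_prob [OF w] mu_sets [OF w]
        by (intro nn_integral_PiM_psum_tsum) auto
      also have "(\<integral>\<^sup>+ x. exp_pos (lam i) (tsum i x) \<partial>\<kappa> w) \<le> E i"
        unfolding E_def
      proof (rule nn_integral_exp_pos_le [OF \<kappa>_prob [OF w] \<nu>(1,2) _ \<nu>(3) _ dom [OF w]])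
        show "tsum i \<in> borel_measurable (\<kappa> w)"
          using measurable_tsum measurable_cong_sets [OF \<kappa>_sets [OF w] refl] by blast
        show "0 < lam i" using lam that by simp
      qed
      finally show "(\<integral>\<^sup>+ x. exp_neg (lam N) (psum N x) * exp_pos (lam i) (tsum i x) \<partial>\<kappa> w)
          \<le> (\<integral>\<^sup>+ x. exp_neg (lam N) (psum N x) \<partial>\<kappa> w) * E i"
        by (simp add: mult_left_mono)
    qed
    also have "\<dots> = L N * E i"
      unfolding L_def
    proof (rule nn_integral_multc)
      show "(\<lambda>w. \<integral>\<^sup>+ x. exp_neg (lam N) (psum N x) \<partial>\<kappa> w) \<in> borel_measurable V"
        by (rule measurable_compose [OF \<kappa>_sub nn_integral_measurable_subprob_algebra]) measurable
    qed
    finally show ?thesis .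
  qed
  have zero: "(\<integral>\<^sup>+ \<omega>. Sup {of_nat (Suc j) | j. \<xi> \<omega> [] j = 0} \<partial>M) < (1 :: ennreal)"
  proof -
    have "{of_nat (Suc j) | j. \<xi> \<omega> [] j = 0} = {of_nat k :: ennreal | k. 1 \<le> k \<and> X \<omega> [k] = 0}" for \<omega>
    proof safe
      fix k assume "1 \<le> k" "X \<omega> [k] = 0"
      then show "\<exists>j. (of_nat k :: ennreal) = of_nat (Suc j) \<and> \<xi> \<omega> [] j = 0"
        by (intro exI [of _ "k - 1"]) (simp add: \<xi>_def)
    qed (force simp: \<xi>_def)
    then show ?thesis using A3a by simp
  qed
  obtain n0 r where n0: "1 \<le> n0" and r: "0 \<le> r" "r < 1"
    and contract: "\<And>N. n0 \<le> N \<Longrightarrow>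
      (\<Sum>i. (\<integral>\<^sup>+ \<omega>. edge_weight lam N (Suc i) (\<xi> \<omega> []) \<partial>M) * L (max N (Suc i))) \<le> ennreal r * L N"
    by (rule edge_weight_contraction [OF \<xi>_meas lam lam_mono lam_all(3) L [symmetric, OF Nil_in_Ulam] E_ge
          sum_EL jump zero]) (assumption+, rule that)
  have g: "edge_weight lam N i \<in> borel_measurable seqM" for N i
    unfolding edge_weight_def [abs_def] by measurable
  have a: "(\<integral>\<^sup>+ \<omega>. edge_weight lam N i (\<xi> \<omega> u) \<partial>M) = (\<integral>\<^sup>+ \<omega>. edge_weight lam N i (\<xi> \<omega> []) \<partial>M)"
    if "u \<in> Ulam" for N i u
    using law [OF that g] law [OF Nil_in_Ulam g] by simp
  \<comment> \<open>The real-valued \<open>Y_0\<close> dominates the whole sum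
    \<open>tsum 0\<close>, so the chance of exceeding \<open>n\<close> vanishes as \<open>n\<close>
    grows.\<close>
  have total: "AE \<omega> in M. \<forall>u\<in>Ulam. (\<Sum>i. \<xi> \<omega> u i) < \<top>"
  proof (rule AE_ball_countable [THEN iffD2], simp, intro ballI)
    fix u assume u: "u \<in> Ulam"
    have "(\<integral>\<^sup>+ \<omega>. indicator {\<top>} (tsum 0 (\<xi> \<omega> u)) \<partial>M)
        = (\<integral>\<^sup>+ w. \<integral>\<^sup>+ x. indicator {\<top>} (tsum 0 x) \<partial>\<kappa> w \<partial>V)"
      by (rule law [OF u]) measurable
    also have "\<dots> = (\<integral>\<^sup>+ w. 0 \<partial>V)"
    proof (rule nn_integral_cong)
      fix w assume "w \<in> space V"
      then have w: "w \<in> space S" by (simp add: space_V)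
      interpret N: prob_space "\<nu> 0" by (rule \<nu>)
      have [measurable]: "tsum 0 \<in> borel_measurable (\<kappa> w)"
        using measurable_tsum measurable_cong_sets [OF \<kappa>_sets [OF w] refl] by blast
      have "(\<integral>\<^sup>+ x. indicator {\<top>} (tsum 0 x) \<partial>\<kappa> w)
          = (\<integral>\<^sup>+ x. indicator {x \<in> space (\<kappa> w). tsum 0 x = \<top>} x \<partial>\<kappa> w)"
        by (intro nn_integral_cong) (auto split: split_indicator)
      also have "\<dots> = emeasure (\<kappa> w) {x \<in> space (\<kappa> w). tsum 0 x = \<top>}"
        by (rule nn_integral_indicator) measurable
      finally have eq: "(\<integral>\<^sup>+ x. indicator {\<top>} (tsum 0 x) \<partial>\<kappa> w)
          = emeasure (\<kappa> w) {x \<in> space (\<kappa> w). tsum 0 x = \<top>}" .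
      have "(\<lambda>n. emeasure (\<nu> 0) {y. real n < y}) \<longlonglongrightarrow> emeasure (\<nu> 0) (\<Inter>n. {y. real n < y})"
        by (rule Lim_emeasure_decseq) (auto simp: \<nu>(2) decseq_def N.emeasure_eq_measure)
      moreover have "(\<Inter>n. {y. real n < y}) = {}"
        using reals_Archimedean2 by (auto dest: less_asym)
      ultimately have lim: "(\<lambda>n. emeasure (\<nu> 0) {y. real n < y}) \<longlonglongrightarrow> 0" by simp
      have "emeasure (\<kappa> w) {x \<in> space (\<kappa> w). tsum 0 x = \<top>} \<le> emeasure (\<nu> 0) {y. real n < y}" for n
      proof -
        have "emeasure (\<kappa> w) {x \<in> space (\<kappa> w). tsum 0 x = \<top>} \<le> emeasure (\<kappa> w) {x \<in> space (\<kappa> w). ennreal (real n) < tsum 0 x}"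
          by (rule emeasure_mono) auto
        also have "\<dots> \<le> emeasure (\<nu> 0) {y. real n < y}" by (rule dom [OF w])
        finally show ?thesis .
      qed
      then have "emeasure (\<kappa> w) {x \<in> space (\<kappa> w). tsum 0 x = \<top>} \<le> 0"
        by (intro LIMSEQ_le_const [OF lim]) auto
      with eq show "(\<integral>\<^sup>+ x. indicator {\<top>} (tsum 0 x) \<partial>\<kappa> w) = 0" by simp
    qed
    finally have "(\<integral>\<^sup>+ \<omega>. indicator {\<top>} (tsum 0 (\<xi> \<omega> u)) \<partial>M) = 0" by simp
    then have "AE \<omega> in M. indicator {\<top>} (tsum 0 (\<xi> \<omega> u)) = (0::ennreal)"
      by (subst (asm) nn_integral_0_iff_AE) auto
    then show "AE \<omega> in M. (\<Sum>i. \<xi> \<omega> u i) < \<top>"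
      by eventually_elim (auto simp: tsum_def less_top split: split_indicator_asm)
  qed
  \<comment> \<open>Almost surely finite partial sums keep \<open>exp_neg\<close> positive; this
    lets \<open>L\<close> act as \<open>b\<close> in \<open>no_explosive_path\<close>.\<close>
  have L_pos: "0 < L N" if "n0 \<le> N" for N
  proof (rule ccontr)
    assume "\<not> 0 < L N"
    then have "(\<integral>\<^sup>+ \<omega>. exp_neg (lam N) (psum N (\<xi> \<omega> [])) \<partial>M) = 0"
      using L [of "[]" N] by (simp add: zero_less_iff_neq_zero)
    then have "AE \<omega> in M. exp_neg (lam N) (psum N (\<xi> \<omega> [])) = 0"
      by (subst (asm) nn_integral_0_iff_AE) auto
    with total have "AE \<omega> in M. False"
    proof eventually_elim
      case (elim \<omega>)
      have "psum N (\<xi> \<omega> []) < \<top>"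
        using elim(1) psum_le_suminf [of N "\<xi> \<omega> []"] by (auto intro: le_less_trans)
      with elim(2) show ?case by (auto simp: exp_neg_def less_top split: if_splits)
    qed
    then show False using AE_contr emeasure_space_1 by (simp add: AE_False)
  qed
  have "AE \<omega> in M. \<forall>N\<ge>n0. (\<Sum>m. pathsum (edge_weight lam) (\<lambda>N x. exp_neg (lam N) (psum N x)) (\<xi> \<omega>) m N []) < \<top>"
  proof (subst AE_all_countable, intro allI AE_impI)
    fix N assume N: "n0 \<le> N"
    show "AE \<omega> in M. (\<Sum>m. pathsum (edge_weight lam) (\<lambda>N x. exp_neg (lam N) (psum N x)) (\<xi> \<omega>) m N []) < \<top>"
      by (rule AE_suminf_pathsum_finite [OF \<xi>_meas \<xi>_ind g _ a L contract r N])
        (use L_fin N n0 in auto)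
  qed
  \<comment> \<open>The constant final weight \<open>L N\<close> has the same expectation as the
    exponential one, so the same contraction applies.\<close>
  moreover have "AE \<omega> in M. \<forall>N\<ge>n0. (\<Sum>m. pathsum (edge_weight lam) (\<lambda>N _. L N) (\<xi> \<omega>) m N []) < \<top>"
  proof (subst AE_all_countable, intro allI AE_impI)
    fix N assume N: "n0 \<le> N"
    show "AE \<omega> in M. (\<Sum>m. pathsum (edge_weight lam) (\<lambda>N _. L N) (\<xi> \<omega>) m N []) < \<top>"
      by (rule AE_suminf_pathsum_finite [OF \<xi>_meas \<xi>_ind g _ a _ contract r N])
        (use L_fin N n0 in \<open>auto simp: emeasure_space_1\<close>)
  qed
  \<comment> \<open>Positivity is assumed at the root and carried to every node by
    \<open>law\<close>.\<close>
  moreover have "AE \<omega> in M. \<forall>u\<in>Ulam. \<forall>n\<ge>1. 0 < tsum n (\<xi> \<omega> u)"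
  proof (rule AE_ball_countable [THEN iffD2], simp, intro ballI)
    fix u assume u: "u \<in> Ulam"
    show "AE \<omega> in M. \<forall>n\<ge>1. 0 < tsum n (\<xi> \<omega> u)"
    proof (subst AE_all_countable, intro allI AE_impI)
      fix n :: nat assume n: "1 \<le> n"
      have h: "(\<lambda>x. indicator {0} (tsum n x) :: ennreal) \<in> borel_measurable seqM" by measurable
      have "(\<integral>\<^sup>+ \<omega>. indicator {0} (tsum n (\<xi> \<omega> u)) \<partial>M) = (\<integral>\<^sup>+ \<omega>. indicator {0} (tsum n (\<xi> \<omega> [])) \<partial>M)"
        using law [OF u h] law [OF Nil_in_Ulam h] by simp
      also have "\<dots> = (\<integral>\<^sup>+ \<omega>. 0 \<partial>M)"
      proof (rule nn_integral_cong_AE)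
        show "AE \<omega> in M. indicator {0} (tsum n (\<xi> \<omega> [])) = (0::ennreal)"
          using A3b [OF n] by eventually_elim (auto simp: \<xi>_def tsum_def add.commute)
      qed
      finally have "(\<integral>\<^sup>+ \<omega>. indicator {0} (tsum n (\<xi> \<omega> u)) \<partial>M) = 0" by simp
      then have "AE \<omega> in M. indicator {0} (tsum n (\<xi> \<omega> u)) = (0::ennreal)"
        by (subst (asm) nn_integral_0_iff_AE) auto
      then show "AE \<omega> in M. 0 < tsum n (\<xi> \<omega> u)"
        by eventually_elim (auto simp: zero_less_iff_neq_zero split: split_indicator_asm)
    qed
  qed
  moreover note total
  ultimately show ?thesis
  proof eventually_elim
    case (elim \<omega>)
    have "\<xi> \<omega> = waits (X \<omega>)" by (simp add: \<xi>_def fun_eq_iff)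
    note * = elim [unfolded this]
    show ?case
    proof (rule infinite_star_if_no_explosive_path)
      show "False"
        if "p 0 = []" "\<And>k. \<exists>i>0. p (Suc k) = p k @ [i]" "t < \<top>" "\<And>k. birth (X \<omega>) (p k) \<le> t"
          "\<And>k. t < birth (X \<omega>) (p k) + (\<Sum>i. waits (X \<omega>) (p k) i)" for p t
        by (rule no_explosive_path [of n0 lam "X \<omega>" L, OF n0 lam _ L_pos _ _ that])
          (use * in auto)
    qed (use * in auto)
  qed
qed

end
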